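(* Let $G$ be a finite connected cubic (3-regular) simple graph of girth $5$ such that its adjacency matrix has no eigenvalues in the open interval $(-2,0)$. Then $G$ is isomorphic either to the Petersen graph or to the dodecahedron.
   Context: Eigenvalues of a graph are those of its adjacency matrix. The girth of a graph is the length of its shortest cycle. *)

theory Defs
  imports
    Complex_Main
    "HOL-Library.Extended_Nat"
    "HOL-Analysis.Product_Vector"
    "Graph_Theory.Graph_Theory"
    "Jordan_Normal_Form.Char_Poly"
begin

text \<open>
  A symmetric digraph contains the closed walk \<open>u, v, u\<close> for every edge, and this counts as a
  cycle of length 2 in \<^const>\<open>pre_digraph.cycle\<close>. Cycles of a simple graph are those of length
  at least 3. The girth of a forest is \<open>\<infinity>\<close>.
\<close>

definition girth :: "'a pair_pre_digraph \<Rightarrow> enat" where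
  "girth G = (INF p \<in> {p. pre_digraph.cycle (with_proj G) p \<and> 3 \<le> length p}. enat (length p))"

definition adjacency_matrix :: "'a pair_pre_digraph \<Rightarrow> 'a list \<Rightarrow> real mat" where
  "adjacency_matrix G vs =
     mat (length vs) (length vs) (\<lambda>(i, j). if (vs ! i, vs ! j) \<in> parcs G then 1 else 0)"

text \<open>The Petersen graph as the Kneser graph on the 2-subsets of a 5-set.\<close>

definition petersen_graph :: "nat set pair_pre_digraph" where
  "petersen_graph =
     \<lparr> pverts = {S. S \<subseteq> {..<5} \<and> card S = 2},
       parcs = {(S, T). S \<subseteq> {..<5} \<and> card S = 2 \<and> T \<subseteq> {..<5} \<and> card T = 2 \<and> S \<inter> T = {}} \<rparr>"

text \<open>
  The graph of the dodecahedron as the generalized Petersen graph with parameters \<open>(10, 2)\<close>.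
  Lemma \<open>dodecahedral_graph_skeleton\<close> below identifies it with the vertices and edges of
  the regular dodecahedron in Euclidean space.
\<close>

definition generalized_petersen :: "nat \<Rightarrow> nat \<Rightarrow> (bool \<times> nat) pair_pre_digraph" where
  "generalized_petersen n k =
     (let E = (\<Union>i<n. {((False, i), (False, (i + 1) mod n)),
                       ((False, i), (True, i)),
                       ((True, i), (True, (i + k) mod n))})
      in \<lparr> pverts = UNIV \<times> {..<n}, parcs = E \<union> E\<inverse> \<rparr>)"

definition dodecahedral_graph :: "(bool \<times> nat) pair_pre_digraph" where
  "dodecahedral_graph = generalized_petersen 10 2"

text \<open>
  In the following list a pair \<open>(a, b)\<close> of integers stands for the coordinate \<open>a + b \<phi>\<close>; the two
  halves list the points assigned to the outer and to the inner vertices.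
\<close>

definition dodecahedron_points :: "((int \<times> int) \<times> (int \<times> int) \<times> (int \<times> int)) list" where
  "dodecahedron_points =
    (let o0 = (0, 0); o1 = (1, 0); n1 = (-1, 0); p = (0, 1); np = (0, -1); q = (-1, 1); nq = (1, -1)
     in [(o1, o1, o1), (q, p, o0), (nq, p, o0), (n1, o1, n1), (np, o0, nq),
         (n1, n1, n1), (nq, np, o0), (q, np, o0), (o1, n1, o1), (p, o0, q),
         (o0, q, p), (o1, o1, n1), (n1, o1, o1), (o0, q, np), (np, o0, q),
         (o0, nq, np), (n1, n1, o1), (o1, n1, n1), (o0, nq, p), (p, o0, nq)])"

definition golden_square :: "int \<times> int \<Rightarrow> int \<times> int \<Rightarrow> int \<times> int" where
  "golden_square x y =
    (let a = fst x - fst y; b = snd x - snd y in (a * a + b * b, 2 * a * b + b * b))"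

definition golden_dist2 ::
  "(int \<times> int) \<times> (int \<times> int) \<times> (int \<times> int) \<Rightarrow> (int \<times> int) \<times> (int \<times> int) \<times> (int \<times> int) \<Rightarrow> int \<times> int" where
  "golden_dist2 u v = (case (u, v) of ((x, y, z), (x', y', z')) \<Rightarrow>
     (fst (golden_square x x') + fst (golden_square y y') + fst (golden_square z z'),
      snd (golden_square x x') + snd (golden_square y y') + snd (golden_square z z')))"

definition dodecahedral_adj :: "bool \<times> nat \<Rightarrow> bool \<times> nat \<Rightarrow> bool" where
  "dodecahedral_adj u v = (case (u, v) of ((b, i), (c, j)) \<Rightarrow>
     if b = c then (let k = if b then 2 else 1 in j = (i + k) mod 10 \<or> i = (j + k) mod 10)
     else i = j)"

lemma dodecahedron_points_distinct: "distinct dodecahedron_points"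
  by code_simp

lemma dodecahedron_points_adj:
  "\<forall>b \<in> set [False, True]. \<forall>c \<in> set [False, True]. \<forall>i \<in> set [0..<10]. \<forall>j \<in> set [0..<10].
     dodecahedral_adj (b, i) (c, j) \<longleftrightarrow>
       golden_dist2 (dodecahedron_points ! (if b then 10 + i else i))
         (dodecahedron_points ! (if c then 10 + j else j)) = (8, -4)"
  by code_simp

lemma golden_norm_eq_0:
  fixes a b :: int
  assumes "a * a + a * b = b * b"
  shows "a = 0 \<and> b = 0"
  using assms
proof (induction "nat (\<bar>a\<bar> + \<bar>b\<bar>)" arbitrary: a b rule: less_induct)
  case less
  have "even (a * a + a * b) \<longleftrightarrow> even (b * b)" using less.prems by simp
  then have "even a" "even b" by auto
  then obtain c d where cd: "a = 2 * c" "b = 2 * d" by (auto elim!: evenE)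
  have "c * c + c * d = d * d" using less.prems by (simp add: cd algebra_simps)
  show ?case
  proof (rule ccontr)
    assume "\<not> ?case"
    then have "nat (\<bar>c\<bar> + \<bar>d\<bar>) < nat (\<bar>a\<bar> + \<bar>b\<bar>)" by (auto simp: cd)
    from less.hyps[OF this] \<open>c * c + c * d = d * d\<close> \<open>\<not> ?case\<close> show False by (simp add: cd)
  qed
qed

text \<open>
  The points below are the standard coordinates of the 20 vertices of the regular
  dodecahedron with edge length \<open>2 / \<phi>\<close>; its edges join the pairs of vertices at that distance.
\<close>

lemma dodecahedral_graph_skeleton:
  fixes p q :: real
  assumes p_def: "p = (1 + sqrt 5) / 2" and q_def: "q = 1 / p"
  shows "\<exists>f :: bool \<times> nat \<Rightarrow> real \<times> real \<times> real.
    bij_betw f (pverts dodecahedral_graph)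
      ({-1, 1} \<times> {-1, 1} \<times> {-1, 1} \<union> {0} \<times> {-q, q} \<times> {-p, p} \<union>
       {-q, q} \<times> {-p, p} \<times> {0} \<union> {-p, p} \<times> {0} \<times> {-q, q}) \<and>
    (\<forall>u \<in> pverts dodecahedral_graph. \<forall>v \<in> pverts dodecahedral_graph.
       (u, v) \<in> parcs dodecahedral_graph \<longleftrightarrow> dist (f u) (f v) = 2 / p)"
proof -
  have p_pos: "p > 0" by (simp add: p_def add_pos_pos)
  have pp: "p * p = p + 1" by (simp add: p_def field_simps)
  then have q: "q = p - 1" using p_pos by (simp add: q_def field_simps)
  have "(2 / p)\<^sup>2 = 4 * (q * q)" by (simp add: q_def power2_eq_square)
  also have "q * q = 2 - p" using pp by (simp add: q algebra_simps)
  finally have edge2: "(2 / p)\<^sup>2 = 8 - 4 * p" by simp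
  define r :: "int \<times> int \<Rightarrow> real" where "r = (\<lambda>x. of_int (fst x) + of_int (snd x) * p)"
  have r_eq_0: "x = (0, 0)" if "r x = 0" for x
  proof -
    obtain a b where x: "x = (a, b)" by (cases x)
    have "(of_int a + of_int b * p) * (of_int a + of_int b * (1 - p)) = (0::real)"
      using that by (simp add: r_def x)
    also have "(of_int a + of_int b * p) * (of_int a + of_int b * (1 - p)) =
        of_int a * of_int a + of_int a * of_int b + of_int b * of_int b * (p - p * p)"
      by (simp add: algebra_simps)
    finally have "of_int (a * a + a * b) = (of_int (b * b) :: real)" by (simp add: pp)
    then have "a * a + a * b = b * b" by (simp only: of_int_eq_iff)
    from golden_norm_eq_0[OF this] show ?thesis by (simp add: x)
  qed
  have r_eq_iff: "r x = r y \<longleftrightarrow> x = y" for x y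
  proof
    assume "r x = r y"
    then have "r (fst x - fst y, snd x - snd y) = 0" by (simp add: r_def algebra_simps)
    from r_eq_0[OF this] show "x = y" by (simp add: prod_eq_iff)
  qed simp
  define g where "g = (\<lambda>(x, y, z). (r x, r y, r z))"
  have g_eq_iff: "g u = g v \<longleftrightarrow> u = v" for u v
    by (cases u; cases v) (simp add: g_def r_eq_iff)
  have r_square: "(r x - r y)\<^sup>2 = r (golden_square x y)" for x y
  proof -
    have *: "(a + b * p) * (a + b * p) = a * a + b * b + (2 * a * b + b * b) * p" for a b :: real
    proof -
      have "(a + b * p) * (a + b * p) = a * a + 2 * a * b * p + b * b * (p * p)"
        by (simp add: algebra_simps)
      then show ?thesis by (simp add: pp algebra_simps)
    qed
    have "r x - r y = of_int (fst x - fst y) + of_int (snd x - snd y) * p"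
      by (simp add: r_def algebra_simps)
    then show ?thesis
      unfolding power2_eq_square golden_square_def Let_def by (simp only: *) (simp add: r_def)
  qed
  have dist_g: "dist (g u) (g v) = 2 / p \<longleftrightarrow> golden_dist2 u v = (8, -4)" for u v
  proof -
    obtain x y z where u: "u = (x, y, z)" by (cases u)
    obtain x' y' z' where v: "v = (x', y', z')" by (cases v)
    have "dist (g u) (g v) = 2 / p \<longleftrightarrow> (dist (g u) (g v))\<^sup>2 = (2 / p)\<^sup>2"
      using p_pos by (subst power2_eq_iff_nonneg) auto
    also have "\<dots> \<longleftrightarrow> (dist (g u) (g v))\<^sup>2 = r (8, -4)"
      by (simp add: edge2 r_def del: power_divide)
    also have "(dist (g u) (g v))\<^sup>2 =
        r (golden_square x x') + (r (golden_square y y') + r (golden_square z z'))"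
      by (simp add: u v g_def dist_prod_def dist_real_def flip: r_square)
    also have "\<dots> = r (golden_dist2 u v)"
      by (simp add: u v golden_dist2_def r_def algebra_simps)
    finally show ?thesis by (simp only: r_eq_iff)
  qed
  define k :: "bool \<times> nat \<Rightarrow> nat" where "k = (\<lambda>(b, i). if b then 10 + i else i)"
  define f where "f = (\<lambda>u. g (dodecahedron_points ! k u))"
  have V: "pverts dodecahedral_graph = UNIV \<times> {..<10}"
    by (simp add: dodecahedral_graph_def generalized_petersen_def Let_def)
  have len: "length dodecahedron_points = 20"
    by (simp add: dodecahedron_points_def Let_def)
  have kV: "bij_betw k (pverts dodecahedral_graph) {..<length dodecahedron_points}"
    unfolding len
  proof (rule bij_betwI[where g = "\<lambda>n. if n < 10 then (False, n) else (True, n - 10)"])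
  qed (auto simp: V k_def split: if_splits)
  have "bij_betw (\<lambda>n. dodecahedron_points ! n) {..<length dodecahedron_points}
      (set dodecahedron_points)"
    using dodecahedron_points_distinct by (rule bij_betw_nth) simp_all
  from bij_betw_trans[OF kV this]
  have "bij_betw (\<lambda>u. dodecahedron_points ! k u) (pverts dodecahedral_graph)
      (set dodecahedron_points)"
    by (simp add: o_def)
  moreover have "bij_betw g (set dodecahedron_points) (g ` set dodecahedron_points)"
    by (simp add: bij_betw_def inj_on_def g_eq_iff)
  ultimately have bij: "bij_betw f (pverts dodecahedral_graph) (g ` set dodecahedron_points)"
    unfolding f_def using bij_betw_trans[unfolded o_def] by blast
  have img: "g ` set dodecahedron_points =
      {-1, 1} \<times> {-1, 1} \<times> {-1, 1} \<union> {0} \<times> {-q, q} \<times> {-p, p} \<union>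
      {-q, q} \<times> {-p, p} \<times> {0} \<union> {-p, p} \<times> {0} \<times> {-q, q}"
  proof -
    have r: "r (0, 0) = 0" "r (1, 0) = 1" "r (-1, 0) = -1" "r (0, 1) = p" "r (0, -1) = -p"
      "r (-1, 1) = q" "r (1, -1) = -q"
      by (simp_all add: r_def q)
    show ?thesis
      unfolding dodecahedron_points_def Let_def list.set image_insert image_empty g_def
        prod.case r
    proof (intro subset_antisym subsetI, goal_cases)
      case (1 t)
      then show ?case by (elim insertE emptyE) simp_all
    next
      case (2 t)
      then show ?case by (elim UnE SigmaE insertE emptyE) (simp_all only: prod.inject insert_iff simp_thms)
    qed
  qed
  have adj: "(u, v) \<in> parcs dodecahedral_graph \<longleftrightarrow> dist (f u) (f v) = 2 / p"
    if "u \<in> pverts dodecahedral_graph" "v \<in> pverts dodecahedral_graph" for u v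
  proof -
    obtain b i where u: "u = (b, i)" by (cases u)
    obtain c j where v: "v = (c, j)" by (cases v)
    have ij: "i < 10" "j < 10" using that by (auto simp: V u v)
    have "(u, v) \<in> parcs dodecahedral_graph \<longleftrightarrow> dodecahedral_adj u v"
      using ij
      by (cases b; cases c)
        (auto simp: u v dodecahedral_graph_def generalized_petersen_def Let_def dodecahedral_adj_def)
    also have "\<dots> \<longleftrightarrow> golden_dist2 (dodecahedron_points ! k u) (dodecahedron_points ! k v) = (8, -4)"
    proof -
      have "b \<in> set [False, True]" "c \<in> set [False, True]" by simp_all
      moreover have "i \<in> set [0..<10]" "j \<in> set [0..<10]" using ij by simp_all
      ultimately show ?thesis
        using dodecahedron_points_adj unfolding u v k_def prod.case by blast
    qed
    also have "\<dots> \<longleftrightarrow> dist (f u) (f v) = 2 / p"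
      by (simp only: f_def dist_g)
    finally show ?thesis .
  qed
  show ?thesis
  proof (intro exI conjI ballI)
    show "bij_betw f (pverts dodecahedral_graph)
      ({-1, 1} \<times> {-1, 1} \<times> {-1, 1} \<union> {0} \<times> {-q, q} \<times> {-p, p} \<union>
       {-q, q} \<times> {-p, p} \<times> {0} \<union> {-p, p} \<times> {0} \<times> {-q, q})"
      using bij unfolding img .
  qed (rule adj)
qed

end

theory Submission
  imports Defs "HOL-Analysis.Function_Topology"
begin

text \<open>
  If the adjacency matrix \<open>A\<close> has no eigenvalue in \<open>(-2, 0)\<close>, then \<open>A(A + 2) = (A + 1)\<^sup>2 - 1\<close> is
  positive semidefinite: a negative eigenvalue \<open>\<mu>\<close> of it would give \<open>A\<close> an eigenvalue
  \<open>-1 \<plusminus> \<surd>(1 + \<mu>)\<close>. Hence \<open>\<parallel>(A + 1) f\<parallel> \<ge> \<parallel>f\<parallel>\<close> for every \<open>f\<close>. For \<open>f\<close> of small support this only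
  involves a small piece of the graph, so it forbids many local configurations. Starting
  from a pentagon, one completes the neighbourhood of one vertex after another in all ways that
  create no cycle of length at most 4. A finite case distinction, in which every dead end is
  refuted by an explicit integer vector \<open>f\<close>, leaves only the Petersen graph and the dodecahedron.
\<close>

section \<open>Negative values of the quadratic form give eigenvalues\<close>

text \<open>The function x(x + 2) is negative exactly on (-2,0), so the spectral hypothesis becomes
  a single quadratic inequality. It is local: (A + 1) f vanishes at distance more than 1 from the
  support of f. The number of vertices of G is not bounded beforehand; it is this inequality that
  stops the growth of the partial graphs.

  A partial graph is a record of known edges, not an induced subgraph: two of its vertices may turn
  out to be adjacent later. Two consequences shape the proof. A vector can refute a partial graph
  only if it is supported on vertices of known degree 3. And embeddings only have to be injective
  and to preserve edges, so they compose, and a graph that contains a settled one is settled too;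
  this keeps the case distinction finite and small.

  A partial graph in which every vertex has degree 3 has an image closed under taking neighbours,
  and connectedness makes this image all of G.\<close>

lemma compact_unit_sphere_finite_support:
  fixes V :: "'a set"
  assumes "finite V"
  shows "compact {f :: 'a \<Rightarrow> real. (\<forall>x. x \<notin> V \<longrightarrow> f x = 0) \<and> (\<Sum>x\<in>V. (f x)\<^sup>2) = 1}" (is "compact ?S")
proof -
  \<comment> \<open>Vectors indexed by \<open>V\<close> are functions on the whole type that vanish
    off \<open>V\<close>. The singleton factors express this, and by Tychonoff the sphere is a
    closed part of a compact product.\<close>
  let ?I = "\<lambda>x. if x \<in> V then {-1..1} else {0 :: real}"
  have "compactin (product_topology (\<lambda>_. euclidean) UNIV) (PiE UNIV ?I)"
    unfolding compactin_PiE by simp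
  then have "compact (PiE UNIV ?I)"
    by (simp add: euclidean_product_topology)
  moreover have "closed {f :: 'a \<Rightarrow> real. (\<Sum>x\<in>V. (f x)\<^sup>2) = 1}"
    by (intro closed_Collect_eq continuous_intros continuous_on_product_coordinates)
  moreover have "?S = PiE UNIV ?I \<inter> {f. (\<Sum>x\<in>V. (f x)\<^sup>2) = 1}"
  proof (intro subset_antisym subsetI)
    fix f assume f: "f \<in> ?S"
    have "\<bar>f x\<bar> \<le> 1" if "x \<in> V" for x
    proof -
      have "(f x)\<^sup>2 \<le> (\<Sum>x\<in>V. (f x)\<^sup>2)"
        using that assms by (intro member_le_sum) auto
      then show ?thesis using f by (simp add: abs_le_square_iff flip: abs_square_le_1)
    qed
    then have "f x \<in> ?I x" for x using f by (auto simp: abs_le_iff)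
    then show "f \<in> PiE UNIV ?I \<inter> {f. (\<Sum>x\<in>V. (f x)\<^sup>2) = 1}" using f by auto
  next
    fix f assume f: "f \<in> PiE UNIV ?I \<inter> {f. (\<Sum>x\<in>V. (f x)\<^sup>2) = 1}"
    then have "f x \<in> ?I x" for x using PiE_mem[of f UNIV ?I x] by blast
    from this have "f x = 0" if "x \<notin> V" for x using that by (metis singletonD)
    then show "f \<in> ?S" using f by auto
  qed
  ultimately show ?thesis by (simp add: compact_Int_closed)
qed

text \<open>First-order condition at a minimum: for small t the linear term outweighs the quadratic
  one. At t = -b/d with d > 0 and d > c the value is (b/d)^2 (c - d), which is negative unless b =
  0.\<close>

lemma linear_coeff_zero_if_quadratic_nonneg:
  fixes b c :: real
  assumes "\<And>t. 0 \<le> t * b + t\<^sup>2 * c"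
  shows "b = 0"
proof (rule ccontr)
  assume "b \<noteq> 0"
  define d where "d = \<bar>c\<bar> + 1"
  have d: "d > 0" "c < d" by (auto simp: d_def)
  have "0 \<le> (- b / d) * b + (- b / d)\<^sup>2 * c" by (rule assms)
  also have "\<dots> = (b\<^sup>2 / d\<^sup>2) * (c - d)"
    using d by (simp add: field_simps power2_eq_square)
  also have "\<dots> < 0" using d \<open>b \<noteq> 0\<close> by (intro mult_pos_neg) auto
  finally show False by simp
qed

text \<open>Rayleigh's principle: the form attains its minimum \<mu> on the compact unit sphere, a
  negative value somewhere makes \<mu> negative, and a minimiser is an eigenvector for
  \<mu>.\<close>

lemma symmetric_negative_eigenvector:
  fixes m :: "'a \<Rightarrow> 'a \<Rightarrow> real"
  assumes fin: "finite V" and sym: "\<And>x y. x \<in> V \<Longrightarrow> y \<in> V \<Longrightarrow> m x y = m y x"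
    and neg: "(\<Sum>x\<in>V. \<Sum>y\<in>V. m x y * f x * f y) < 0"
  obtains \<mu> h where "\<mu> < 0" "\<exists>x\<in>V. h x \<noteq> 0" "\<And>x. x \<in> V \<Longrightarrow> (\<Sum>y\<in>V. m x y * h y) = \<mu> * h x"
proof -
  define B where "B f g = (\<Sum>x\<in>V. \<Sum>y\<in>V. m x y * f x * g y)" for f g :: "'a \<Rightarrow> real"
  define N where "N f = (\<Sum>x\<in>V. (f x)\<^sup>2)" for f :: "'a \<Rightarrow> real"
  define S where "S = {f :: 'a \<Rightarrow> real. (\<forall>x. x \<notin> V \<longrightarrow> f x = 0) \<and> N f = 1}"
  have N0: "N f \<ge> 0" for f by (simp add: N_def sum_nonneg)
  have Nf: "N f = 0 \<longleftrightarrow> (\<forall>x\<in>V. f x = 0)" for f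
    unfolding N_def using fin by (subst sum_nonneg_eq_0_iff) auto
  have B0: "B f f = 0" if "N f = 0" for f using that by (simp add: Nf B_def)
  have Bscale: "B (\<lambda>x. c * f x) (\<lambda>x. c * f x) = c\<^sup>2 * B f f" for c f
    unfolding B_def sum_distrib_left by (simp add: power2_eq_square ac_simps)
  have Nscale: "N (\<lambda>x. c * f x) = c\<^sup>2 * N f" for c f
    unfolding N_def sum_distrib_left by (simp add: power_mult_distrib)
  have normalise: "\<exists>g\<in>S. B f f = N f * B g g" if "N f \<noteq> 0" for f
  proof
    define c where "c = 1 / sqrt (N f)"
    have Np: "N f > 0" using N0[of f] that by simp
    have c2: "c\<^sup>2 * N f = 1" using Np by (simp add: c_def power_divide)
    let ?g = "\<lambda>x. c * (if x \<in> V then f x else 0)"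
    have 1: "N (\<lambda>x. if x \<in> V then f x else 0) = N f"
      "B (\<lambda>x. if x \<in> V then f x else 0) (\<lambda>x. if x \<in> V then f x else 0) = B f f"
      by (simp_all add: N_def B_def cong: sum.cong)
    have "N ?g = 1" unfolding Nscale 1 using c2 .
    then show "?g \<in> S" by (simp add: S_def)
    have "B ?g ?g = c\<^sup>2 * B f f" unfolding Bscale 1 ..
    then show "B f f = N f * B ?g ?g" using c2 by (simp add: mult.assoc[symmetric] mult.commute[of "N f"])
  qed
  have "B f f < 0" using neg by (simp add: B_def)
  then have "N f \<noteq> 0" using B0 by fastforce
  from normalise[OF this] obtain g where g: "g \<in> S" "B f f = N f * B g g" by blast
  have "B g g < 0"
    using \<open>B f f < 0\<close> g(2) N0[of f] by (simp add: mult_less_0_iff)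
  have "compact S" unfolding S_def N_def by (rule compact_unit_sphere_finite_support[OF fin])
  moreover have "continuous_on S (\<lambda>f. B f f)"
    unfolding B_def
    by (intro continuous_intros) (rule continuous_on_subset[OF continuous_on_product_coordinates], simp)+
  ultimately obtain h where h: "h \<in> S" "\<And>f. f \<in> S \<Longrightarrow> B h h \<le> B f f"
    using continuous_attains_inf[of S "\<lambda>f. B f f"] g(1) by blast
  define \<mu> where "\<mu> = B h h"
  have "\<mu> < 0" using h(2)[OF g(1)] \<open>B g g < 0\<close> by (simp add: \<mu>_def)
  have Nh: "N h = 1" using h(1) by (simp add: S_def)
  have min: "\<mu> * N f \<le> B f f" for f
  proof (cases "N f = 0")
    case True
    then have "B f f = 0" by (rule B0)
    with True show ?thesis by simp
  next
    case False
    from normalise[OF this] obtain g where "g \<in> S" "B f f = N f * B g g" by blast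
    then show ?thesis using h(2)[of g] N0[of f]
      by (simp add: \<mu>_def mult.commute mult_left_mono)
  qed
  have eig: "(\<Sum>y\<in>V. m x y * h y) = \<mu> * h x" if x: "x \<in> V" for x
  proof -
    define e :: "'a \<Rightarrow> real" where "e = (\<lambda>y. if y = x then 1 else 0)"
    define r where "r = (\<Sum>y\<in>V. m x y * h y)"
    have Beh: "B e h = r"
      unfolding B_def r_def e_def using x fin
      by (simp add: if_distrib if_distribR sum.delta' cong: if_cong flip: sum_distrib_left)
         (subst sum.mono_neutral_right[of V "{x}"], auto)
    have Bhe: "B h e = r"
      unfolding Beh[symmetric] B_def
      by (subst sum.swap) (auto intro!: sum.cong simp: sym)
    have Nadd: "N (\<lambda>y. h y + t * e y) = N h + 2 * t * h x + t\<^sup>2" for t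
    proof -
      have "N (\<lambda>y. h y + t * e y) = (\<Sum>y\<in>V. (h y)\<^sup>2 + (if y = x then 2 * t * h x + t\<^sup>2 else 0))"
        unfolding N_def e_def by (intro sum.cong) (auto simp: power2_eq_square algebra_simps)
      then show ?thesis using x fin by (simp add: sum.distrib N_def)
    qed
    have Badd: "B (\<lambda>y. h y + t * e y) (\<lambda>y. h y + t * e y) = B h h + t * B h e + t * B e h + t\<^sup>2 * B e e" for t
      unfolding B_def sum_distrib_left sum.distrib[symmetric]
      by (intro sum.cong refl) (simp add: power2_eq_square algebra_simps)
    \<comment> \<open>The minimiser is varied in the direction of the coordinate vector
      \<open>e\<close> at \<open>x\<close>; the linear coefficient is twice the defect of the
      eigenvalue equation at \<open>x\<close>.\<close>
    have "0 \<le> t * (2 * r - 2 * \<mu> * h x) + t\<^sup>2 * (B e e - \<mu>)" for t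
      using min[of "\<lambda>y. h y + t * e y"] unfolding Nadd Badd Beh Bhe Nh
      by (simp add: \<mu>_def algebra_simps)
    then have "2 * r - 2 * \<mu> * h x = 0" by (rule linear_coeff_zero_if_quadratic_nonneg)
    then show ?thesis by (simp add: r_def)
  qed
  show ?thesis
  proof (rule that[OF \<open>\<mu> < 0\<close> _ eig])
    show "\<exists>x\<in>V. h x \<noteq> 0" using Nf[of h] Nh by auto
  qed
qed

text \<open>In the proof \<open>b\<close> is the matrix of A + 1, \<open>B\<close> its action and
  \<open>m\<close> the matrix of (A + 1)^2 - 1. An eigenvector h of \<open>m\<close> for \<mu> < 0
  satisfies (B - s)(B + s) h = 0 with s = sqrt (1 + \<mu>). Either (B + s) h = 0 and A h = (-1 - s)
  h, or (B + s) h is itself an eigenvector of A, for s - 1. As 0 \<le> s < 1, both values lie in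
  (-2,0).\<close>

lemma adjacency_eigenfunction:
  fixes N :: "'a \<Rightarrow> 'a set" and f :: "'a \<Rightarrow> real"
  assumes fin: "finite V" and sub: "\<And>x. x \<in> V \<Longrightarrow> N x \<subseteq> V"
    and sym: "\<And>x y. y \<in> N x \<Longrightarrow> x \<in> N y"
    and irrefl: "\<And>x. x \<notin> N x"
    and neg: "(\<Sum>x\<in>V. (f x + sum f (N x))\<^sup>2) < (\<Sum>x\<in>V. (f x)\<^sup>2)"
  obtains k :: real and h :: "'a \<Rightarrow> real" where "- 2 < k" "k < 0" "\<exists>x\<in>V. h x \<noteq> 0"
    "\<And>x. x \<in> V \<Longrightarrow> sum h (N x) = k * h x"
proof -
  define b :: "'a \<Rightarrow> 'a \<Rightarrow> real" where "b x y = (if x = y \<or> y \<in> N x then 1 else 0)" for x y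
  define B where "B f x = f x + sum f (N x)" for f :: "'a \<Rightarrow> real" and x
  define m where "m x y = (\<Sum>z\<in>V. b x z * b z y) - (if x = y then 1 else 0)" for x y
  have b: "(\<Sum>y\<in>V. b x y * f y) = B f x" if x: "x \<in> V" for f x
  proof -
    have "(\<Sum>y\<in>V. b x y * f y) = (\<Sum>y\<in>insert x (N x). b x y * f y)"
      using sub[OF x] x fin by (intro sum.mono_neutral_right) (auto simp: b_def)
    also have "\<dots> = (\<Sum>y\<in>insert x (N x). f y)" by (intro sum.cong) (auto simp: b_def)
    also have "\<dots> = B f x"
      using irrefl finite_subset[OF sub[OF x] fin] by (simp add: B_def)
    finally show ?thesis .
  qed
  have bsym: "b x y = b y x" for x y using sym by (auto simp: b_def)
  have msym: "m x y = m y x" for x y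
    unfolding m_def using bsym by (auto simp: mult.commute intro!: sum.cong)
  have mapp: "(\<Sum>y\<in>V. m x y * f y) = B (B f) x - f x" if x: "x \<in> V" for f x
  proof -
    have "(\<Sum>y\<in>V. m x y * f y) = (\<Sum>y\<in>V. \<Sum>z\<in>V. b x z * (b z y * f y)) - (\<Sum>y\<in>V. if x = y then f y else 0)"
      unfolding m_def sum_subtractf[symmetric] 
      by (intro sum.cong) (auto simp: sum_distrib_left sum_distrib_right left_diff_distrib right_diff_distrib ac_simps)
    also have "(\<Sum>y\<in>V. \<Sum>z\<in>V. b x z * (b z y * f y)) = (\<Sum>z\<in>V. b x z * B f z)"
      by (subst sum.swap) (simp add: b flip: sum_distrib_left)
    also have "\<dots> = B (B f) x" by (rule b[OF x])
    finally show ?thesis using x fin by simp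
  qed
  have adjoint: "(\<Sum>x\<in>V. f x * B g x) = (\<Sum>x\<in>V. B f x * g x)" for f g
  proof -
    have "(\<Sum>x\<in>V. f x * B g x) = (\<Sum>x\<in>V. \<Sum>y\<in>V. b y x * f x * g y)"
      using bsym by (simp add: sum_distrib_left ac_simps flip: b)
    also have "\<dots> = (\<Sum>x\<in>V. B f x * g x)"
      by (subst sum.swap) (simp add: sum_distrib_right flip: b)
    finally show ?thesis .
  qed
  have "(\<Sum>x\<in>V. \<Sum>y\<in>V. m x y * f x * f y) = (\<Sum>x\<in>V. f x * (\<Sum>y\<in>V. m x y * f y))"
    by (simp add: sum_distrib_left ac_simps)
  also have "\<dots> = (\<Sum>x\<in>V. f x * B (B f) x) - (\<Sum>x\<in>V. (f x)\<^sup>2)"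
    by (simp add: mapp right_diff_distrib power2_eq_square sum_subtractf)
  also have "\<dots> = (\<Sum>x\<in>V. (B f x)\<^sup>2) - (\<Sum>x\<in>V. (f x)\<^sup>2)"
    by (simp add: adjoint power2_eq_square)
  also have "\<dots> < 0" using neg by (simp add: B_def)
  finally obtain \<mu> h where \<mu>: "\<mu> < 0" and h0: "\<exists>x\<in>V. h x \<noteq> 0"
    and h: "\<And>x. x \<in> V \<Longrightarrow> (\<Sum>y\<in>V. m x y * h y) = \<mu> * h x"
    using symmetric_negative_eigenvector[OF fin, of m f] msym by blast
  have BB: "B (B h) x = (1 + \<mu>) * h x" if "x \<in> V" for x
    using h[OF that] mapp[OF that, of h] by (simp add: algebra_simps)
  have pos: "(\<Sum>x\<in>V. (h x)\<^sup>2) > 0"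
    using h0 fin by (metis sum_pos2 zero_le_power2 zero_less_power2)
  \<comment> \<open>The square norm of (A + 1) h is 1 + \<mu> times that of h, so \<mu> \<ge> -1 and
    the square root taken below is a genuine one.\<close>
  have "0 \<le> (\<Sum>x\<in>V. (B h x)\<^sup>2)" by (simp add: sum_nonneg)
  also have "\<dots> = (\<Sum>x\<in>V. h x * B (B h) x)" by (simp add: adjoint power2_eq_square)
  also have "\<dots> = (1 + \<mu>) * (\<Sum>x\<in>V. (h x)\<^sup>2)"
    by (simp add: BB sum_distrib_left power2_eq_square ac_simps)
  finally have nn: "0 \<le> 1 + \<mu>" using pos by (simp add: zero_le_mult_iff)
  define s where "s = sqrt (1 + \<mu>)"
  have s: "0 \<le> s" "s < 1" "s * s = 1 + \<mu>" using nn \<mu> by (auto simp: s_def real_sqrt_lt_1_iff)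
  define g where "g x = B h x + s * h x" for x
  show ?thesis
  proof (cases "\<exists>x\<in>V. g x \<noteq> 0")
    case False
    then have "sum h (N x) = (- 1 - s) * h x" if "x \<in> V" for x
      using that by (simp add: g_def B_def algebra_simps eq_neg_iff_add_eq_0)
    with s h0 show ?thesis by (intro that[of "- 1 - s" h]) auto
  next
    case True
    have "B g x = s * g x" if x: "x \<in> V" for x
    proof -
      have "B g x = B (B h) x + s * B h x"
        by (simp add: g_def[abs_def] B_def sum.distrib sum_distrib_left algebra_simps)
      also have "\<dots> = s * g x" unfolding BB[OF x] s(3)[symmetric] by (simp add: g_def algebra_simps)
      finally show ?thesis .
    qed
    then have "sum g (N x) = (s - 1) * g x" if "x \<in> V" for x
      using that by (simp add: B_def algebra_simps eq_diff_eq)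
    with s True show ?thesis by (intro that[of "s - 1" g]) auto
  qed
qed

lemma eigenvalue_adjacency_matrixI:
  fixes h :: "'a \<Rightarrow> real"
  assumes "distinct vs" and "\<And>x. x \<in> set vs \<Longrightarrow> (\<Sum>y | y \<in> set vs \<and> (x, y) \<in> parcs G. h y) = k * h x"
    and "\<exists>x\<in>set vs. h x \<noteq> 0"
  shows "eigenvalue (adjacency_matrix G vs) k"
proof -
  define n where "n = length vs"
  define v where "v = vec n (\<lambda>i. h (vs ! i))"
  have "eigenvector (adjacency_matrix G vs) v k"
    unfolding eigenvector_def
  proof (intro conjI)
    show "v \<in> carrier_vec (dim_row (adjacency_matrix G vs))"
      by (simp add: v_def n_def adjacency_matrix_def)
    from assms(3) obtain i where "i < n" "h (vs ! i) \<noteq> 0"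
      by (auto simp: n_def in_set_conv_nth)
    then show "v \<noteq> 0\<^sub>v (dim_row (adjacency_matrix G vs))"
      by (auto simp: v_def n_def adjacency_matrix_def dest!: arg_cong[where f = "\<lambda>w. w $ i"])
    show "adjacency_matrix G vs *\<^sub>v v = k \<cdot>\<^sub>v v"
    proof (rule eq_vecI)
      fix i assume "i < dim_vec (k \<cdot>\<^sub>v v)"
      then have i: "i < n" by (simp add: v_def)
      have "(adjacency_matrix G vs *\<^sub>v v) $ i =
          (\<Sum>j<n. (if (vs ! i, vs ! j) \<in> parcs G then 1 else 0) * h (vs ! j))"
        using i by (simp add: adjacency_matrix_def v_def n_def scalar_prod_def lessThan_atLeast0)
      also have "\<dots> = (\<Sum>y\<in>set vs. (if (vs ! i, y) \<in> parcs G then 1 else 0) * h y)"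
        by (intro sum.reindex_bij_betw bij_betw_nth) (auto simp: n_def assms)
      also have "\<dots> = (\<Sum>y | y \<in> set vs \<and> (vs ! i, y) \<in> parcs G. h y)"
        by (intro sum.mono_neutral_cong_right) auto
      also have "\<dots> = (k \<cdot>\<^sub>v v) $ i" using assms(2)[of "vs ! i"] i by (simp add: v_def n_def)
      finally show "(adjacency_matrix G vs *\<^sub>v v) $ i = (k \<cdot>\<^sub>v v) $ i" .
    qed (simp add: v_def n_def adjacency_matrix_def)
  qed
  then show ?thesis by (auto simp: eigenvalue_def)
qed

section \<open>Certificates for growing a partial graph\<close>

text \<open>Vertices are the positions; entry i lists the neighbours of i found so far. An entry
  with fewer than three elements is incomplete, and the missing neighbours may be old or new
  vertices.\<close>

type_synonym adj_lists = "nat list list"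

text \<open>
  A certificate settles a partial graph. \<open>Branch v cs\<close> completes the neighbourhood of \<open>v\<close> in all
  possible ways and settles each result; \<open>Negative f\<close> gives a vector on which the quadratic form is
  negative; \<open>Contains i p\<close> says that \<open>p\<close> maps the \<open>i\<close>-th settled graph into the current one. The
  settled graphs are numbered in the order in which their branches are closed, after those given
  at the start.
\<close>

datatype cert = Negative "int list" | Contains nat "nat list" | Branch nat "cert list"

text \<open>
  An edge between \<open>v\<close> and a vertex \<open>w\<close> with \<open>within_distance_3 g v w\<close>, or edges from
  \<open>v\<close> to two vertices \<open>a\<close> and \<open>b\<close> with \<open>within_distance_2 g a b\<close>, would create a cycle of length at most 4.
\<close>

definition within_distance_3 :: "adj_lists \<Rightarrow> nat \<Rightarrow> nat \<Rightarrow> bool" where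
  "within_distance_3 g v w \<longleftrightarrow> w = v \<or> w \<in> set (g ! v) \<or>
     (\<exists>u \<in> set (g ! v). w \<in> set (g ! u) \<or> (\<exists>x \<in> set (g ! u). x \<noteq> v \<and> w \<in> set (g ! x)))"

definition within_distance_2 :: "adj_lists \<Rightarrow> nat \<Rightarrow> nat \<Rightarrow> bool" where
  "within_distance_2 g a b \<longleftrightarrow> b \<in> set (g ! a) \<or> (\<exists>z \<in> set (g ! a). b \<in> set (g ! z))"

fun short_subseqs :: "nat \<Rightarrow> 'b list \<Rightarrow> 'b list list" where
  "short_subseqs 0 xs = [[]]"
| "short_subseqs (Suc k) [] = [[]]"
| "short_subseqs (Suc k) (x # xs) = map ((#) x) (short_subseqs k xs) @ short_subseqs (Suc k) xs"

definition attach_neighbours :: "adj_lists \<Rightarrow> nat \<Rightarrow> nat list \<Rightarrow> nat \<Rightarrow> adj_lists" where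
  "attach_neighbours g v ws k =
     map (\<lambda>i. if i = v then g ! i @ ws @ [length g..<length g + k]
              else if i \<in> set ws then g ! i @ [v] else g ! i) [0..<length g] @ replicate k [v]"

text \<open>A child is determined by the set of old vertices that are joined to \<open>v\<close>:
  the remaining neighbours are new and interchangeable, so only their number counts. The order of
  the children is that of \<open>short_subseqs\<close>, and a certificate lists its subcertificates
  in the same order.\<close>

definition children :: "adj_lists \<Rightarrow> nat \<Rightarrow> adj_lists list" where
  "children g v =
     map (\<lambda>ws. attach_neighbours g v ws (3 - length (g ! v) - length ws))
       (filter (sorted_wrt (\<lambda>a b. \<not> within_distance_2 g a b))
         (short_subseqs (3 - length (g ! v))
           (filter (\<lambda>w. length (g ! w) < 3 \<and> \<not> within_distance_3 g v w) [0..<length g])))"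

definition wf_adj_lists :: "adj_lists \<Rightarrow> bool" where
  "wf_adj_lists g \<longleftrightarrow> (\<forall>i \<in> set [0..<length g]. length (g ! i) \<le> 3 \<and> distinct (g ! i) \<and>
     (\<forall>j \<in> set (g ! i). j < length g \<and> i \<in> set (g ! j)))"

definition quadratic_form :: "adj_lists \<Rightarrow> int list \<Rightarrow> int" where
  "quadratic_form g f = (\<Sum>i\<leftarrow>[0..<length g]. (f ! i + (\<Sum>j\<leftarrow>g ! i. f ! j))\<^sup>2 - (f ! i)\<^sup>2)"

text \<open>
  The support of \<open>f\<close> is confined to vertices whose three neighbours are all known, so the value
  of the form does not depend on the rest of the graph.
\<close>

definition negative_vector :: "adj_lists \<Rightarrow> int list \<Rightarrow> bool" where
  "negative_vector g f \<longleftrightarrow> length f = length g \<and>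
     (\<forall>i \<in> set [0..<length g]. length (g ! i) = 3 \<or> f ! i = 0) \<and> quadratic_form g f < 0"

text \<open>Only edges have to be preserved; \<open>g\<close> may have further edges between the
  vertices of the copy.\<close>

definition contains_copy :: "adj_lists \<Rightarrow> adj_lists \<Rightarrow> nat list \<Rightarrow> bool" where
  "contains_copy g h p \<longleftrightarrow> length p = length h \<and> distinct p \<and>
    (\<forall>i \<in> set [0..<length h]. p ! i < length g \<and> (\<forall>j \<in> set (h ! i). p ! j \<in> set (g ! (p ! i))))"

text \<open>The result is the enlarged list of settled graphs. A branching node is appended only
  after all its children, so \<open>Contains\<close> cannot cite an open ancestor and no circular
  argument arises. Well-formedness is tested at the nodes by evaluation, which spares a proof that
  \<open>children\<close> preserves it.\<close>

fun check_cert :: "adj_lists list \<Rightarrow> adj_lists \<Rightarrow> cert \<Rightarrow> adj_lists list option"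
  and check_certs :: "adj_lists list \<Rightarrow> adj_lists list \<Rightarrow> cert list \<Rightarrow> adj_lists list option" where
  "check_cert K g (Negative f) = (if wf_adj_lists g \<and> negative_vector g f then Some K else None)"
| "check_cert K g (Contains i p) = (if i < length K \<and> contains_copy g (K ! i) p then Some K else None)"
| "check_cert K g (Branch v cs) =
     (if wf_adj_lists g \<and> v < length g then
       (case check_certs K (children g v) cs of None \<Rightarrow> None | Some K' \<Rightarrow> Some (K' @ [g])) else None)"
| "check_certs K [] [] = Some K"
| "check_certs K (g # gs) (c # cs) =
     (case check_cert K g c of None \<Rightarrow> None | Some K' \<Rightarrow> check_certs K' gs cs)"
| "check_certs K [] (c # cs) = None"
| "check_certs K (g # gs) [] = None"

section \<open>Soundness of certificates\<close>

lemma wf_adj_listsD: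
  assumes "wf_adj_lists g" "i < length g"
  shows "length (g ! i) \<le> 3" "distinct (g ! i)"
    "j \<in> set (g ! i) \<Longrightarrow> j < length g" "j \<in> set (g ! i) \<Longrightarrow> i \<in> set (g ! j)"
proof -
  have "i \<in> set [0..<length g]" using assms(2) by simp
  then show "length (g ! i) \<le> 3" "distinct (g ! i)"
    "j \<in> set (g ! i) \<Longrightarrow> j < length g" "j \<in> set (g ! i) \<Longrightarrow> i \<in> set (g ! j)"
    using assms(1) unfolding wf_adj_lists_def by blast+
qed

text \<open>The local properties on which the search rests. The last assumption is the spectral
  hypothesis in the form that (A + 1)^2 - 1 is positive semidefinite.\<close>

locale spectral_cubic_graph =
  fixes V :: "'a set" and N :: "'a \<Rightarrow> 'a set"
  assumes finite_V: "finite V"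
    and N_sub: "x \<in> V \<Longrightarrow> N x \<subseteq> V"
    and N_sym: "y \<in> N x \<Longrightarrow> x \<in> N y"
    and N_irrefl: "x \<notin> N x"
    and card_N: "x \<in> V \<Longrightarrow> card (N x) = 3"
    and no_triangle: "y \<in> N x \<Longrightarrow> z \<in> N x \<Longrightarrow> z \<notin> N y"
    and no_square: "x \<noteq> z \<Longrightarrow> y \<in> N x \<Longrightarrow> y \<in> N z \<Longrightarrow> w \<in> N x \<Longrightarrow> w \<in> N z \<Longrightarrow> y = w"
    and form_nonneg: "\<And>f :: 'a \<Rightarrow> real. (\<Sum>x\<in>V. (f x)\<^sup>2) \<le> (\<Sum>x\<in>V. (f x + sum f (N x))\<^sup>2)"
begin

definition embedding :: "(nat \<Rightarrow> 'a) \<Rightarrow> adj_lists \<Rightarrow> bool" where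
  "embedding \<phi> g \<longleftrightarrow> inj_on \<phi> {..<length g} \<and> \<phi> ` {..<length g} \<subseteq> V \<and>
     (\<forall>i<length g. \<forall>j\<in>set (g ! i). \<phi> j \<in> N (\<phi> i))"

lemma finite_N: "x \<in> V \<Longrightarrow> finite (N x)"
  using N_sub finite_V finite_subset by blast

lemma N_saturated:
  assumes \<phi>: "embedding \<phi> g" and g: "wf_adj_lists g" and i: "i < length g" "length (g ! i) = 3"
  shows "N (\<phi> i) = \<phi> ` set (g ! i)"
proof (rule card_subset_eq[symmetric])
  have "\<phi> i \<in> V" using \<phi> i by (auto simp: embedding_def)
  then show "finite (N (\<phi> i))" by (rule finite_N)
  show "\<phi> ` set (g ! i) \<subseteq> N (\<phi> i)" using \<phi> i by (auto simp: embedding_def)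
  have "set (g ! i) \<subseteq> {..<length g}" using wf_adj_listsD(3)[OF g i(1)] by auto
  then have "card (\<phi> ` set (g ! i)) = card (set (g ! i))"
    using \<phi> by (intro card_image) (auto simp: embedding_def intro: inj_on_subset)
  also have "\<dots> = 3" using wf_adj_listsD(2)[OF g i(1)] i by (simp add: distinct_card)
  finally show "card (\<phi> ` set (g ! i)) = card (N (\<phi> i))" using card_N[OF \<open>\<phi> i \<in> V\<close>] by simp
qed

text \<open>Extended by zero, the vector gives a function on G with the same value of the form,
  because every edge at a support vertex is listed in \<open>g\<close>. This value is negative,
  contrary to \<open>form_nonneg\<close>.\<close>

lemma not_embedding_if_negative_vector:
  assumes g: "wf_adj_lists g" and f: "negative_vector g f"
  shows "\<not> embedding \<phi> g"
proof
  assume \<phi>: "embedding \<phi> g"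
  define n where "n = length g"
  have inj: "inj_on \<phi> {..<n}" and V: "\<phi> ` {..<n} \<subseteq> V"
    using \<phi> unfolding embedding_def n_def by blast+
  have gn: "j < n" if "i < n" "j \<in> set (g ! i)" for i j using wf_adj_listsD(3)[OF g] that by (simp add: n_def)
  define F where "F x = (if x \<in> \<phi> ` {..<n} then f ! the_inv_into {..<n} \<phi> x else 0)" for x
  have F: "F (\<phi> i) = f ! i" if "i < n" for i
    using that inj by (simp add: F_def the_inv_into_f_f)
  have supp: "\<exists>i<n. x = \<phi> i \<and> length (g ! i) = 3" if "F x \<noteq> 0" for x
  proof -
    from that obtain i where i: "i < n" "x = \<phi> i" by (auto simp: F_def split: if_splits)
    with that F have "f ! i \<noteq> 0" by simp
    with i f show ?thesis by (auto simp: negative_vector_def n_def)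
  qed
  have inside: "sum F (N (\<phi> i)) = (\<Sum>j\<leftarrow>g ! i. f ! j)" if i: "i < n" for i
  proof -
    have Vi: "\<phi> i \<in> V" using V i by auto
    have sub: "\<phi> ` set (g ! i) \<subseteq> N (\<phi> i)" using \<phi> i by (auto simp: embedding_def n_def)
    \<comment> \<open>An unlisted edge at \<open>\<phi> i\<close> cannot end in the support, where
      all three edges are listed, in both directions by symmetry of the lists.\<close>
    have "F y = 0" if y: "y \<in> N (\<phi> i) - \<phi> ` set (g ! i)" for y
    proof (rule ccontr)
      assume "F y \<noteq> 0"
      from supp[OF this] obtain j where j: "j < n" "y = \<phi> j" "length (g ! j) = 3" by blast
      have "\<phi> i \<in> N (\<phi> j)" using y j(2) N_sym by blast
      then have "\<phi> i \<in> \<phi> ` set (g ! j)" using N_saturated[OF \<phi> g] j by (simp add: n_def)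
      then have "i \<in> set (g ! j)" using inj i gn[OF j(1)] by (auto dest: inj_onD)
      then have "j \<in> set (g ! i)" using wf_adj_listsD(4)[OF g] j unfolding n_def by blast
      then show False using y j by blast
    qed
    then have "sum F (N (\<phi> i)) = sum F (\<phi> ` set (g ! i))"
      using sub finite_N[OF Vi] by (intro sum.mono_neutral_right) auto
    also have "\<dots> = (\<Sum>j\<in>set (g ! i). F (\<phi> j))"
    proof (rule sum.reindex_cong[OF _ refl refl])
      show "inj_on \<phi> (set (g ! i))" using inj gn[OF i] by (auto intro: inj_on_subset)
    qed
    also have "\<dots> = (\<Sum>j\<in>set (g ! i). f ! j)" using gn[OF i] F by (intro sum.cong) auto
    also have "\<dots> = (\<Sum>j\<leftarrow>g ! i. f ! j)"
      using wf_adj_listsD(2)[OF g] i by (intro sum.distinct_set_conv_list) (simp add: n_def)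
    finally show ?thesis .
  qed
  \<comment> \<open>All neighbours of a support vertex lie in the image, so a vertex off the image
    sees only zeros.\<close>
  have outside: "sum F (N y) = 0" if y: "y \<in> V - \<phi> ` {..<n}" for y
  proof (rule sum.neutral, rule ballI, rule ccontr)
    fix x assume x: "x \<in> N y" "F x \<noteq> 0"
    from supp[OF x(2)] obtain j where j: "j < n" "x = \<phi> j" "length (g ! j) = 3" by blast
    have "y \<in> \<phi> ` set (g ! j)" using N_saturated[OF \<phi> g] j N_sym[OF x(1)] by (simp add: n_def)
    then show False using y gn[OF j(1)] by auto
  qed
  have "(\<Sum>x\<in>V. (F x + sum F (N x))\<^sup>2 - (F x)\<^sup>2) =
      (\<Sum>x\<in>\<phi> ` {..<n}. (F x + sum F (N x))\<^sup>2 - (F x)\<^sup>2)"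
    using V finite_V outside by (intro sum.mono_neutral_right) (auto simp: F_def)
  also have "\<dots> = (\<Sum>i<n. (F (\<phi> i) + sum F (N (\<phi> i)))\<^sup>2 - (F (\<phi> i))\<^sup>2)"
    by (rule sum.reindex_cong[OF inj refl refl])
  also have "\<dots> = quadratic_form g f"
    by (simp add: F inside quadratic_form_def n_def lessThan_atLeast0 flip: sum.distinct_set_conv_list)
  also have "\<dots> < 0" using f by (simp add: negative_vector_def)
  finally have "(\<Sum>x\<in>V. (F x + sum F (N x))\<^sup>2) < (\<Sum>x\<in>V. (F x)\<^sup>2)"
    by (simp add: sum_subtractf)
  then have "real_of_int (\<Sum>x\<in>V. (F x + sum F (N x))\<^sup>2) < real_of_int (\<Sum>x\<in>V. (F x)\<^sup>2)"
    by (simp only: of_int_less_iff)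
  then show False
    using form_nonneg[of "\<lambda>x. real_of_int (F x)"] by simp
qed

lemma embedding_if_contains_copy:
  assumes \<phi>: "embedding \<phi> g" and p: "contains_copy g h p" and h: "\<forall>ns\<in>set h. \<forall>j\<in>set ns. j < length h"
  shows "embedding (\<lambda>i. \<phi> (p ! i)) h"
proof -
  have *: "length p = length h" "distinct p" "\<And>i. i < length h \<Longrightarrow> p ! i < length g"
    "\<And>i j. i < length h \<Longrightarrow> j \<in> set (h ! i) \<Longrightarrow> p ! j \<in> set (g ! (p ! i))"
    using p by (auto simp: contains_copy_def)
  show ?thesis
    unfolding embedding_def
  proof (intro conjI allI impI ballI)
    show "inj_on (\<lambda>i. \<phi> (p ! i)) {..<length h}"
    proof (rule inj_onI)
      fix i j assume ij: "i \<in> {..<length h}" "j \<in> {..<length h}" "\<phi> (p ! i) = \<phi> (p ! j)"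
      then have "p ! i = p ! j"
        using \<phi> *(3)[of i] *(3)[of j] by (auto simp: embedding_def dest: inj_onD)
      then show "i = j" using ij *(1,2) by (simp add: nth_eq_iff_index_eq)
    qed
    show "(\<lambda>i. \<phi> (p ! i)) ` {..<length h} \<subseteq> V" using \<phi> * by (auto simp: embedding_def)
    show "\<phi> (p ! j) \<in> N (\<phi> (p ! i))" if "i < length h" "j \<in> set (h ! i)" for i j
      using \<phi> * that by (auto simp: embedding_def)
  qed
qed

end

lemma filter_in_short_subseqs: "length (filter P xs) \<le> k \<Longrightarrow> filter P xs \<in> set (short_subseqs k xs)"
proof (induction k xs rule: short_subseqs.induct)
  case (3 k x xs)
  then show ?case by (cases "P x") auto
qed auto

lemma length_attach_neighbours [simp]: "length (attach_neighbours g v ws k) = length g + k"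
  by (simp add: attach_neighbours_def)

lemma attach_neighbours_nth:
  "i < length g \<Longrightarrow> attach_neighbours g v ws k ! i =
     (if i = v then g ! i @ ws @ [length g..<length g + k] else if i \<in> set ws then g ! i @ [v] else g ! i)"
  "length g \<le> i \<Longrightarrow> i < length g + k \<Longrightarrow> attach_neighbours g v ws k ! i = [v]"
  by (simp_all add: attach_neighbours_def nth_append)

section \<open>Completeness of the branching step\<close>

context spectral_cubic_graph
begin

text \<open>The actual neighbourhood of \<open>\<phi> v\<close> selects the child. Its unlisted
  members inside the image form \<open>ws\<close> and pass both filters, for otherwise G would have
  a loop, a triangle or a 4-cycle, or a vertex with too many neighbours. Its members outside the
  image become the new vertices.\<close>

lemma embedding_children:
  assumes \<phi>: "embedding \<phi> g" and g: "wf_adj_lists g" and v: "v < length g"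
  shows "\<exists>h\<in>set (children g v). \<exists>\<psi>. embedding \<psi> h"
proof -
  define n where "n = length g"
  have inj: "inj_on \<phi> {..<n}" and V: "\<phi> ` {..<n} \<subseteq> V"
    using \<phi> unfolding embedding_def n_def by blast+
  have edge: "\<phi> j \<in> N (\<phi> i)" if "i < n" "j \<in> set (g ! i)" for i j
    using \<phi> that by (auto simp: embedding_def n_def)
  have gn: "j < n" "i \<in> set (g ! j)" if "i < n" "j \<in> set (g ! i)" for i j
    using wf_adj_listsD(3,4)[OF g] that unfolding n_def by blast+
  have \<phi>_eq: "\<phi> i = \<phi> j \<longleftrightarrow> i = j" if "i < n" "j < n" for i j
    using inj that by (auto dest: inj_onD)
  have vn: "v < n" and vV: "\<phi> v \<in> V" using v V by (auto simp: n_def)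
  define P where "P w \<longleftrightarrow> \<phi> w \<in> N (\<phi> v) \<and> w \<notin> set (g ! v)" for w
  define c where "c = filter (\<lambda>w. length (g ! w) < 3 \<and> \<not> within_distance_3 g v w) [0..<length g]"
  define ws where "ws = filter P c"
  have Pc: "w \<in> set c" if w: "w < n" "P w" for w
  proof -
    have "length (g ! w) \<noteq> 3"
    proof
      assume "length (g ! w) = 3"
      then have "N (\<phi> w) = \<phi> ` set (g ! w)" using N_saturated[OF \<phi> g] w by (simp add: n_def)
      then have "\<phi> v \<in> \<phi> ` set (g ! w)" using w N_sym by (auto simp: P_def)
      then have "v \<in> set (g ! w)" using gn[OF w(1)] vn \<phi>_eq by auto
      then show False using gn[OF w(1)] w by (auto simp: P_def)
    qed
    moreover have "length (g ! w) \<le> 3" using wf_adj_listsD(1)[OF g] w by (simp add: n_def)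
    moreover have "\<not> within_distance_3 g v w"
    proof
      assume "within_distance_3 g v w"
      then consider "w = v" | "w \<in> set (g ! v)" | u where "u \<in> set (g ! v)" "w \<in> set (g ! u)"
        | u x where "u \<in> set (g ! v)" "x \<in> set (g ! u)" "x \<noteq> v" "w \<in> set (g ! x)"
        unfolding within_distance_3_def by blast
      then show False
      proof cases
        case 1
        then show False using w N_irrefl by (auto simp: P_def)
      next
        case 2
        then show False using w by (auto simp: P_def)
      next
        case 3
        then show False using no_triangle edge vn gn w(2) unfolding P_def by blast
      next
        case 4
        \<comment> \<open>Along the path v, u, x, w closed by the edge from w to v, the vertices v
          and x have the common neighbours u and w. Hence u = w, although the edge from v to u is
          listed and the one to w is not.\<close>
        have "u < n" "x < n" using 4 gn vn by blast+
        have "\<phi> u = \<phi> w"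
        proof (rule no_square)
          show "\<phi> v \<noteq> \<phi> x" using 4 \<phi>_eq \<open>x < n\<close> vn by auto
          show "\<phi> u \<in> N (\<phi> v)" using edge 4 vn by auto
          show "\<phi> u \<in> N (\<phi> x)" using edge 4 \<open>u < n\<close> N_sym by auto
          show "\<phi> w \<in> N (\<phi> v)" using w by (simp add: P_def)
          show "\<phi> w \<in> N (\<phi> x)" using edge 4 \<open>x < n\<close> by auto
        qed
        then have "u = w" using \<phi>_eq \<open>u < n\<close> w by auto
        then show False using 4 w by (auto simp: P_def)
      qed
    qed
    ultimately show ?thesis using w by (simp add: c_def n_def)
  qed
  have set_ws: "set ws = {w. w < n \<and> P w}" using Pc by (auto simp: ws_def c_def n_def)
  have dist_ws: "distinct ws" by (simp add: ws_def c_def)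
  have dist_v: "distinct (g ! v)" using wf_adj_listsD(2)[OF g v] .
  define R where "R = N (\<phi> v) - \<phi> ` {..<n}"
  have old: "N (\<phi> v) \<inter> \<phi> ` {..<n} = \<phi> ` (set (g ! v) \<union> set ws)"
    using edge[OF vn] gn[OF vn] by (auto simp: set_ws P_def)
  have "card (\<phi> ` (set (g ! v) \<union> set ws)) = card (set (g ! v) \<union> set ws)"
    using inj gn[OF vn] by (intro card_image) (auto simp: set_ws intro: inj_on_subset)
  also have "\<dots> = length (g ! v) + length ws"
  proof -
    have "set (g ! v) \<inter> set ws = {}" by (auto simp: set_ws P_def)
    then show ?thesis using dist_v dist_ws by (simp add: card_Un_disjoint distinct_card)
  qed
  finally have card_old: "card (N (\<phi> v) \<inter> \<phi> ` {..<n}) = length (g ! v) + length ws"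
    by (simp add: old)
  have "card (N (\<phi> v)) = card (N (\<phi> v) \<inter> \<phi> ` {..<n}) + card R"
    using finite_N[OF vV] card_Int_Diff R_def by metis
  \<comment> \<open>This count shows that the natural subtraction in \<open>k\<close> does not
    truncate and that exactly \<open>k\<close> neighbours are new.\<close>
  then have sum3: "length (g ! v) + length ws + card R = 3"
    using card_N[OF vV] card_old by simp
  define k where "k = 3 - length (g ! v) - length ws"
  have k: "k = card R" using sum3 by (simp add: k_def)
  obtain rs where rs: "set rs = R" "distinct rs"
    using finite_distinct_list[of R] finite_N[OF vV] by (auto simp: R_def)
  have lrs: "length rs = k" using rs k by (simp flip: distinct_card)
  have far: "sorted_wrt (\<lambda>a b. \<not> within_distance_2 g a b) ws"
  proof (rule sorted_wrt_mono_rel[of _ "(\<noteq>)"])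
    show "sorted_wrt (\<noteq>) ws" using dist_ws by (induction ws) auto
    fix a b assume a: "a \<in> set ws" and b: "b \<in> set ws" and ab: "a \<noteq> b"
    have an: "a < n" "\<phi> a \<in> N (\<phi> v)" "a \<notin> set (g ! v)" using a by (auto simp: set_ws P_def)
    have bn: "b < n" "\<phi> b \<in> N (\<phi> v)" using b by (auto simp: set_ws P_def)
    show "\<not> within_distance_2 g a b"
    proof
      assume "within_distance_2 g a b"
      then consider "b \<in> set (g ! a)" | z where "z \<in> set (g ! a)" "b \<in> set (g ! z)"
        unfolding within_distance_2_def by blast
      then show False
      proof cases
        case 1
        then show False using no_triangle edge an bn by blast
      next
        case 2
        have zn: "z < n" using gn 2 an by blast
        have "z \<noteq> v" using gn 2 an by blast
        have "\<phi> a = \<phi> b"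
        proof (rule no_square)
          show "\<phi> v \<noteq> \<phi> z" using \<open>z \<noteq> v\<close> \<phi>_eq zn vn by auto
          show "\<phi> a \<in> N (\<phi> z)" using edge[OF an(1) 2(1)] N_sym by blast
          show "\<phi> b \<in> N (\<phi> z)" using edge 2 zn by blast
        qed (use an bn in auto)
        then show False using ab \<phi>_eq an bn by auto
      qed
    qed
  qed
  have "ws \<in> set (short_subseqs (3 - length (g ! v)) c)"
    unfolding ws_def using sum3 by (intro filter_in_short_subseqs) (simp add: ws_def[symmetric])
  with far have child: "attach_neighbours g v ws k \<in> set (children g v)"
    by (auto simp: children_def k_def c_def)
  define \<psi> where "\<psi> i = (if i < n then \<phi> i else rs ! (i - n))" for i
  have new: "\<psi> i \<in> R" if "n \<le> i" "i < n + k" for i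
    using that lrs rs(1) nth_mem[of "i - n" rs] by (simp add: \<psi>_def)
  have "embedding \<psi> (attach_neighbours g v ws k)"
    unfolding embedding_def length_attach_neighbours
  proof (intro conjI allI impI ballI)
    show "inj_on \<psi> {..<length g + k}"
    proof (rule inj_onI)
      fix i j assume i: "i \<in> {..<length g + k}" and j: "j \<in> {..<length g + k}" and eq: "\<psi> i = \<psi> j"
      have mixed: "\<psi> a \<noteq> \<psi> b" if "a < n" "n \<le> b" "b < n + k" for a b
      proof -
        have "\<psi> a \<in> \<phi> ` {..<n}" using that by (simp add: \<psi>_def)
        then show ?thesis using new[OF that(2,3)] by (auto simp: R_def)
      qed
      consider "i < n" "j < n" | "n \<le> i" "n \<le> j"
        using mixed[of i j] mixed[of j i] i j eq by (force simp: n_def)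
      then show "i = j"
      proof cases
        case 1
        then show ?thesis using eq \<phi>_eq by (simp add: \<psi>_def)
      next
        case 2
        then have "i - n = j - n"
          using eq i j rs(2) lrs by (subst nth_eq_iff_index_eq[symmetric, of rs]) (auto simp: \<psi>_def n_def)
        then show ?thesis using 2 by simp
      qed
    qed
    show "\<psi> ` {..<length g + k} \<subseteq> V"
    proof
      fix y assume "y \<in> \<psi> ` {..<length g + k}"
      then obtain i where i: "i < n + k" "y = \<psi> i" by (auto simp: n_def)
      show "y \<in> V"
      proof (cases "i < n")
        case True
        then show ?thesis using V i by (auto simp: \<psi>_def)
      next
        case False
        then have "y \<in> N (\<phi> v)" using new[of i] i by (auto simp: R_def)
        then show ?thesis using N_sub[OF vV] by blast
      qed
    qed
    have newN: "\<psi> i \<in> N (\<psi> v)" if "n \<le> i" "i < n + k" for i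
      using new[OF that] vn by (simp add: R_def \<psi>_def)
    have wsN: "\<psi> w \<in> N (\<psi> v)" if "w \<in> set ws" for w
      using that vn by (auto simp: set_ws P_def \<psi>_def)
    have oldN: "\<psi> j \<in> N (\<psi> i)" if "i < n" "j \<in> set (g ! i)" for i j
      using edge[OF that] gn[OF that] that by (simp add: \<psi>_def)
    fix i j assume i: "i < length g + k" and j: "j \<in> set (attach_neighbours g v ws k ! i)"
    show "\<psi> j \<in> N (\<psi> i)"
    proof (cases "i < n")
      case True
      then show ?thesis
        using j oldN[OF True] wsN newN N_sym
        by (auto simp: attach_neighbours_nth(1)[of i g] n_def split: if_splits)
    next
      case False
      then show ?thesis using j i newN N_sym by (auto simp: attach_neighbours_nth(2)[of g i] n_def)
    qed
  qed
  with child show ?thesis by blast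
qed

end

section \<open>Induction over certificates\<close>

definition closed_adj_lists :: "adj_lists \<Rightarrow> bool" where
  "closed_adj_lists h \<longleftrightarrow> (\<forall>ns\<in>set h. \<forall>j\<in>set ns. j < length h)"

context spectral_cubic_graph
begin

text \<open>The meaning of "settled". With \<open>P\<close> the desired conclusion it covers both
  kinds of leaf: a refuted graph forces \<open>P\<close> vacuously, a target graph because G is then
  recognised.\<close>

definition embedding_forces :: "bool \<Rightarrow> adj_lists \<Rightarrow> bool" where
  "embedding_forces P g \<longleftrightarrow> ((\<exists>\<phi>. embedding \<phi> g) \<longrightarrow> P)"

text \<open>The invariant is that every graph in the list of settled graphs forces \<open>P\<close>.
  At a branching node some child embeds whenever the graph does; at a citation the embedding is
  composed with the copy.\<close>

lemma
  shows check_cert_sound: "check_cert K g c = Some K' \<Longrightarrow> \<forall>h\<in>set K. embedding_forces P h \<and> closed_adj_lists h \<Longrightarrow>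
      embedding_forces P g \<and> (\<forall>h\<in>set K'. embedding_forces P h \<and> closed_adj_lists h)"
    and check_certs_sound: "check_certs K gs cs = Some K' \<Longrightarrow> \<forall>h\<in>set K. embedding_forces P h \<and> closed_adj_lists h \<Longrightarrow>
      (\<forall>g\<in>set gs. embedding_forces P g) \<and> (\<forall>h\<in>set K'. embedding_forces P h \<and> closed_adj_lists h)"
proof (induction K g c and K gs cs arbitrary: K' and K' rule: check_cert_check_certs.induct)
  case (1 K g f)
  then show ?case using not_embedding_if_negative_vector by (auto simp: embedding_forces_def split: if_splits)
next
  case (2 K g i p)
  then have "contains_copy g (K ! i) p" "K ! i \<in> set K" "K' = K" by (auto split: if_splits)
  then have "embedding_forces P g"
    using 2(2) embedding_if_contains_copy unfolding embedding_forces_def closed_adj_lists_def by blast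
  with 2 \<open>K' = K\<close> show ?case by simp
next
  case (3 K g v cs)
  then obtain K1 where K1: "wf_adj_lists g" "v < length g" "check_certs K (children g v) cs = Some K1"
    "K' = K1 @ [g]"
    by (auto split: if_splits option.splits)
  have IH: "(\<forall>g\<in>set (children g v). embedding_forces P g)" "(\<forall>h\<in>set K1. embedding_forces P h \<and> closed_adj_lists h)"
    using "3.IH"[OF _ K1(3) "3.prems"(2)] K1(1,2) by simp_all
  have "embedding_forces P g"
    using IH(1) embedding_children[OF _ K1(1,2)] unfolding embedding_forces_def by blast
  moreover have "closed_adj_lists g"
    unfolding closed_adj_lists_def all_set_conv_all_nth[of g] using wf_adj_listsD(3)[OF K1(1)] by blast
  ultimately show ?case using IH(2) K1(4) by auto
next
  case (5 K g gs c cs)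
  then obtain K1 where K1: "check_cert K g c = Some K1" "check_certs K1 gs cs = Some K'"
    by (auto split: option.splits)
  have *: "embedding_forces P g" "\<forall>h\<in>set K1. embedding_forces P h \<and> closed_adj_lists h"
    using "5.IH"(1)[OF K1(1) "5.prems"(2)] by simp_all
  show ?case using "5.IH"(2)[OF K1(1) K1(2) *(2)] *(1) by simp
qed simp_all

end

section \<open>The case distinction\<close>

definition pentagon_lists :: adj_lists where
  "pentagon_lists = [[1,4], [2,0], [3,1], [4,2], [0,3]]"

definition petersen_lists :: adj_lists where
  "petersen_lists =
    [[1,4,5], [2,0,6], [3,1,7], [4,2,8], [0,3,9], [7,8,0], [8,9,1], [9,5,2], [5,6,3], [6,7,4]]"

definition dodecahedral_lists :: adj_lists where
  "dodecahedral_lists =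
    [[1,9,10], [2,0,11], [3,1,12], [4,2,13], [5,3,14], [6,4,15], [7,5,16], [8,6,17], [9,7,18],
    [0,8,19], [12,18,0], [13,19,1], [14,10,2], [15,11,3], [16,12,4], [17,13,5], [18,14,6],
    [19,15,7], [10,16,8], [11,17,9]]"

text \<open>
  Found by computer search: the branching vertex was chosen so as to leave few children that are
  neither refuted by a vector nor isomorphic to a state met before.
\<close>

definition pentagon_certificate :: cert where
  "pentagon_certificate =
    Branch 0 [Branch 1 [Branch 2 [Branch 3 [Branch 4 [Branch 5 [Branch 7 [
    Branch 8 [Branch 6 [Contains 0 [0,1,2,3,4,5,6,7,8,9],
    Branch 9 [Negative [0,0,0,0,1,0,1,1,-1,-1,0], Negative [0,0,-2,0,2,0,2,3,-3,-3,0,0]]],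
    Branch 9 [Contains 2 [0,5,7,2,1,4,8,9,3,6,10], Contains 2 [3,2,7,5,8,4,1,9,0,10,6],
    Negative [0,-3,0,0,4,1,0,3,-3,-5,0,0]]], Branch 8 [Contains 4 [0,4,3,2,1,5,9,8,7,6,10],
    Negative [0,-3,4,4,-3,7,0,-6,-6,0,0,0]]], Branch 7 [Contains 6 [0,1,2,7,5,4,6,3,9,10,8],
    Branch 8 [Negative [0,0,0,-1,1,-1,0,1,1,0,0,0], Negative [-3,2,-2,0,2,0,0,2,-1,0,0,0],
    Negative [0,0,0,-2,2,-2,0,2,1,0,0,0,0], Negative [0,0,0,-3,2,-3,0,2,1,0,0,0],
    Negative [0,0,0,-1,1,-1,0,1,1,0,0,0,0], Branch 11 [Negative [-1,2,-2,0,0,0,0,2,1,0,0,-2,0],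
    Negative [0,0,0,-2,3,-2,0,3,0,0,0,-1,0],
    Branch 12 [Negative [-1,2,-2,0,0,0,0,0,2,0,0,0,-2,0],
    Negative [0,0,0,0,-2,2,0,0,3,0,0,-2,-2,0], Negative [0,0,0,-2,2,-2,0,2,0,0,0,0,1,0,0],
    Negative [0,0,0,0,1,-2,0,2,-2,0,0,0,2,0],
    Branch 6 [Negative [0,0,0,0,-2,2,-2,-2,0,3,0,1,-1,0,0],
    Negative [0,0,0,0,0,0,2,1,2,-2,0,-2,0,0,0], Negative [0,0,0,-2,2,-2,0,2,0,-1,0,0,0,0,0,0],
    Negative [0,0,0,-2,2,-2,1,2,0,0,0,0,0,0,0], Negative [0,0,0,-2,2,-2,1,2,0,0,0,0,0,0,0],
    Negative [0,0,0,-2,2,-2,1,2,0,0,0,0,0,0,0,0], Negative [0,0,-2,0,0,0,2,2,2,0,0,-2,-1,0,0],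
    Negative [0,-2,0,0,0,0,2,2,0,0,0,-2,1,0,0,0], Negative [-3,0,-2,0,3,0,2,2,0,0,0,0,-2,0,0,0],
    Negative [-9,0,-8,0,9,0,6,11,0,0,0,-4,-2,0,0,0,0]],
    Negative [0,0,0,0,-2,2,0,0,3,0,0,-2,-2,0,0], Negative [0,0,0,-2,2,-2,0,2,0,0,0,0,1,0,0,0]]],
    Negative [0,0,0,-2,2,-2,0,2,1,0,0,0,0,0]]], Contains 12 [0,4,3,2,1,5,9,8,7,6,10],
    Branch 7 [Negative [-3,0,2,0,1,2,0,-3,0,0,0,0], Negative [-3,0,2,0,1,2,0,-3,0,0,0,0],
    Contains 12 [2,3,4,0,1,7,8,9,5,6,12],
    Branch 10 [Branch 6 [Negative [0,2,0,3,-2,0,-3,-2,0,0,3,0,0],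
    Negative [0,-2,0,2,-3,2,3,0,0,0,-3,0,0], Contains 9 [10,6,1,0,5,7,13,2,4,11,12,3,9,8]],
    Negative [0,-1,0,2,-2,2,0,0,0,0,-2,0,0], Negative [0,1,0,2,-2,0,0,-2,0,0,2,0,0],
    Negative [0,-2,2,0,-1,2,0,0,0,0,-2,0,0,0]], Contains 14 [0,1,2,3,4,5,6,7,8,9,11,10,12],
    Branch 8 [Negative [-2,0,0,2,0,2,0,-1,-2,0,0,0,0,0],
    Negative [-2,0,0,2,0,2,0,-1,-2,0,0,0,0,0], Contains 12 [3,2,1,0,4,8,7,6,5,9,12],
    Contains 12 [3,2,1,0,4,8,7,6,5,9,13], Negative [-8,7,-3,7,0,3,0,-3,-6,0,0,0,0,0,0],
    Contains 14 [0,4,3,2,1,5,9,8,7,6,10,11,12], Contains 14 [0,4,3,2,1,5,9,8,7,6,10,11,13],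
    Negative [-2,0,0,2,0,2,0,-1,-2,0,0,0,0,0,0], Contains 14 [0,4,3,2,1,5,9,8,7,6,11,10,12],
    Contains 14 [0,4,3,2,1,5,9,8,7,6,11,10,13], Negative [-2,0,0,2,0,2,0,-1,-2,0,0,0,0,0,0],
    Branch 12 [Contains 12 [2,7,12,8,3,1,13,6,14,4,0], Contains 12 [3,8,12,7,2,4,14,9,13,1,0],
    Branch 10 [Contains 14 [2,7,12,8,3,1,13,10,14,4,6,0,5],
    Contains 14 [3,8,12,7,2,4,14,10,13,1,9,0,5],
    Branch 11 [Branch 6 [Negative [0,0,0,0,-2,4,-2,3,3,0,-2,0,-4,0,0,0],
    Negative [0,0,0,0,5,-4,6,0,-8,0,0,-3,7,0,0,0],
    Negative [0,0,-6,0,0,7,5,9,6,0,0,-8,-10,0,0,0],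
    Negative [0,0,-6,0,0,7,5,9,6,0,0,-8,-10,0,0,0,0]],
    Negative [0,0,0,0,0,2,0,2,1,0,0,-2,-2,0,0,0], Negative [0,0,0,0,0,2,0,1,2,0,0,-2,-2,0,0,0],
    Negative [0,0,0,0,-2,3,0,2,3,0,0,-2,-4,0,0,0,0],
    Negative [0,0,0,0,0,2,0,2,1,0,0,-2,-2,0,0,0], Negative [0,0,0,0,0,2,0,1,2,0,0,-2,-2,0,0,0],
    Negative [0,-2,0,0,0,3,0,3,2,0,0,-2,-4,0,0,0,0],
    Negative [0,0,0,0,0,1,0,1,1,0,0,-1,-1,0,0,0], Negative [0,0,0,0,0,2,0,2,1,0,0,-2,-2,0,0,0,0],
    Negative [0,0,0,0,0,2,0,1,2,0,0,-2,-2,0,0,0,0],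
    Negative [0,0,0,0,-2,3,0,2,3,0,0,-2,-4,0,0,0,0,0]]],
    Contains 17 [0,1,2,3,4,5,6,7,8,9,11,10,12,13,14],
    Branch 15 [Negative [0,0,0,-2,2,-1,0,0,0,0,0,0,2,0,0,-2],
    Negative [-2,2,0,0,0,1,0,-1,0,0,0,0,2,0,0,-2], Negative [-2,2,0,0,0,1,0,-1,0,0,0,0,2,0,0,-2],
    Negative [0,-2,2,0,0,1,0,0,0,0,0,0,-2,0,0,2,0],
    Negative [-2,0,0,0,2,1,0,0,-1,0,0,0,2,0,0,-2], Negative [-2,0,0,0,2,1,0,0,-1,0,0,0,2,0,0,-2],
    Negative [0,0,0,-2,2,-1,0,0,0,0,0,0,2,0,0,-2,0],
    Branch 10 [Negative [0,0,0,8,-5,6,0,-6,-7,0,-9,0,6,0,0,4,0],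
    Negative [0,-5,8,0,0,6,0,-7,-6,0,-9,0,6,0,0,4,0],
    Negative [-3,2,0,0,1,0,0,-2,0,0,2,0,2,0,0,-2,0],
    Negative [-3,1,0,0,2,0,0,0,-2,0,2,0,2,0,0,-2,0],
    Negative [0,0,0,8,-5,6,0,-6,-7,0,-9,0,6,0,0,4,0,0]],
    Contains 18 [0,1,2,3,4,5,6,7,8,9,11,10,12,13,14,15,16],
    Branch 10 [Negative [-7,4,0,0,4,4,0,-3,-3,0,-3,0,5,0,0,-1,0,0],
    Negative [0,-4,11,-8,5,-6,0,-10,0,0,9,0,6,0,0,0,0,0],
    Negative [0,-4,0,0,10,-11,0,0,-15,0,14,0,12,0,0,-3,0,0],
    Branch 6 [Negative [0,0,0,0,-2,2,2,0,1,0,-3,0,-2,0,0,2,0,0],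
    Negative [0,0,0,-2,2,-2,-1,0,0,0,3,0,2,0,0,-2,0,0],
    Negative [0,0,0,3,0,2,4,0,-4,0,-5,0,0,0,0,3,0,0],
    Negative [-6,5,5,0,0,4,-6,-6,-1,0,0,0,0,0,0,4,0,0],
    Negative [0,0,0,-2,2,-2,-1,0,0,0,3,0,2,0,0,-2,0,0,0]],
    Contains 19 [0,1,2,3,4,5,6,7,8,9,10,11,12,13,14,15,17,16],
    Branch 6 [Negative [0,0,0,-3,4,-3,-3,0,0,0,4,0,2,0,0,-1,0,0,0],
    Branch 13 [Negative [0,0,0,0,-2,0,-2,0,3,0,0,0,-4,3,0,2,0,0,0],
    Negative [0,-5,0,0,2,4,12,0,-6,0,-6,0,10,-9,0,-5,0,0,0],
    Negative [0,0,0,-8,0,0,0,10,9,0,3,0,-5,-9,0,-3,0,0,0],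
    Branch 16 [Negative [0,0,-2,0,2,0,2,0,-1,0,-2,0,0,2,0,2,-4,0,0],
    Negative [0,0,0,0,0,-2,0,0,0,0,2,0,0,-2,0,-1,2,0,0],
    Negative [0,0,0,0,0,1,0,0,3,0,-2,0,-4,4,0,3,-4,0,0],
    Branch 18 [Negative [0,0,0,0,-10,12,0,-6,8,0,-18,0,0,9,0,-7,0,0,11],
    Negative [0,0,0,0,0,0,0,0,-2,0,-1,0,2,0,0,0,-2,0,2],
    Branch 9 [Branch 11 [Negative [0,0,0,0,0,0,0,0,0,-6,-8,9,0,1,0,-7,3,0,5,0],
    Branch 17 [Contains 1 [0,1,6,13,16,15,17,14,9,4,5,2,10,7,18,12,19,8,11,3],
    Negative [0,0,0,0,0,0,0,3,0,0,4,0,-5,-5,4,5,5,-6,-6,0,0],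
    Negative [0,0,0,0,0,0,-7,0,0,5,6,-6,0,5,0,-6,0,8,0,-3,0],
    Negative [0,0,0,0,-2,6,0,-3,0,3,-8,-5,5,5,0,-7,-3,4,8,0,0,0]],
    Negative [0,0,0,0,0,0,-3,2,0,2,5,-3,-3,0,0,2,0,0,-3,0,0]],
    Negative [0,0,0,0,-7,0,0,-3,5,8,-3,0,3,0,0,-11,8,0,0,0],
    Negative [0,0,0,0,0,5,5,-4,0,-4,-11,0,6,0,0,-5,0,0,7,0],
    Negative [0,0,-4,0,5,0,4,0,-4,-3,-5,0,7,0,0,-2,-4,0,5,0,0],
    Negative [0,0,0,0,0,0,-4,5,5,-4,6,0,-11,0,0,7,0,0,-5,0],
    Negative [0,0,0,0,-5,0,-5,3,3,6,9,0,-8,0,0,4,5,0,-11,0],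
    Negative [0,0,0,-2,3,-2,0,2,0,-1,2,0,0,-2,0,0,0,0,0,0,0],
    Negative [0,0,0,0,-2,0,0,0,0,3,0,0,1,-1,0,-3,4,0,-2,0],
    Negative [0,0,0,0,-7,0,0,-3,5,8,-3,0,3,0,0,-11,8,0,0,0,0],
    Negative [0,0,0,0,-2,0,0,0,2,2,1,0,-2,0,0,0,2,0,-3,0,0],
    Negative [0,0,0,0,-9,7,0,0,8,6,-4,0,-7,0,0,0,6,0,-4,0,0,0]]],
    Negative [0,0,0,-2,2,-2,0,2,0,0,2,0,0,-3,0,0,1,0,0,0]],
    Contains 24 [0,1,2,3,4,5,6,7,8,9,10,11,12,13,14,15,17,16,18],
    Negative [0,0,0,-2,2,-2,0,2,0,0,2,0,0,-2,0,-1,0,0,0,0]],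
    Negative [0,0,-5,7,0,0,6,0,-6,0,-4,0,0,0,0,2,0,0,0],
    Negative [0,0,-8,0,0,0,9,5,1,0,-6,0,3,0,0,-7,0,0,0],
    Negative [0,0,-8,0,0,0,9,5,1,0,-6,0,3,0,0,-7,0,0,0],
    Negative [-5,5,5,-5,3,0,-6,-6,0,0,4,0,4,0,0,0,0,0,0,0]],
    Negative [0,-10,0,0,4,11,0,15,0,0,-14,0,-12,0,0,3,0,0],
    Negative [0,5,-8,11,-4,-6,0,0,-10,0,9,0,6,0,0,0,0,0],
    Contains 19 [0,4,3,2,1,5,9,8,7,6,10,11,12,14,13,15,16,17],
    Contains 19 [0,4,3,2,1,5,9,8,7,6,10,11,12,14,13,15,17,16],
    Contains 26 [0,4,3,2,1,5,9,8,7,6,10,11,12,14,13,15,16,17,18],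
    Negative [0,0,0,0,-1,2,0,1,2,0,-2,0,-2,0,0,0,0,0],
    Negative [0,0,0,0,-1,2,0,2,1,0,-2,0,-3,0,0,2,0,0],
    Negative [0,0,0,0,-1,2,0,2,1,0,-2,0,-3,0,0,2,0,0],
    Negative [0,-6,0,0,-3,10,0,12,5,0,-11,0,-13,0,0,3,0,0,0],
    Negative [0,0,0,0,-1,2,0,0,2,0,-2,0,-2,0,0,1,0,0],
    Negative [0,0,0,0,-1,2,0,0,2,0,-2,0,-2,0,0,1,0,0],
    Negative [0,3,0,0,6,-10,0,-5,-12,0,11,0,13,0,0,-3,0,0,0],
    Negative [0,-1,0,2,-2,2,0,0,0,0,-2,0,-2,0,0,2,0,0,0],
    Negative [0,-1,0,2,-2,2,0,0,0,0,-2,0,-2,0,0,2,0,0,0],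
    Branch 11 [Negative [-7,5,0,0,5,0,0,-4,-4,0,3,-2,7,0,0,-2,0,0,0,0],
    Negative [0,0,3,-4,3,-5,0,-4,0,0,2,4,3,0,0,0,0,0,0,0],
    Negative [0,0,0,0,-3,5,0,0,4,0,-2,-4,-3,0,0,0,0,0,0,0],
    Negative [0,0,0,-2,2,-3,0,0,0,0,1,2,2,0,0,-2,0,0,0,0],
    Negative [0,0,0,-2,2,-3,0,0,0,0,1,2,2,0,0,-2,0,0,0,0],
    Contains 26 [0,1,2,3,4,5,6,7,8,9,11,10,12,13,14,15,16,17,20],
    Negative [0,-3,0,0,0,5,0,4,0,0,-2,-4,-3,0,0,0,0,0,0,0],
    Negative [0,7,-7,0,3,-11,0,0,-5,0,5,6,8,0,0,-4,0,0,0,0],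
    Negative [0,5,0,-5,3,-9,0,-3,0,0,4,6,8,0,0,-6,0,0,0,0],
    Negative [0,5,0,-5,3,-9,0,-3,0,0,4,6,8,0,0,-6,0,0,0,0],
    Contains 26 [0,4,3,2,1,5,9,8,7,6,11,10,12,14,13,15,16,17,20],
    Negative [0,0,0,0,0,4,0,4,4,0,-1,-5,-6,0,0,1,0,0,0,0],
    Negative [0,0,0,0,0,4,0,4,1,0,-1,-5,-6,0,0,4,0,0,0,0],
    Negative [0,0,0,0,0,4,0,4,1,0,-1,-5,-6,0,0,4,0,0,0,0],
    Negative [0,0,3,-4,3,-5,0,-4,0,0,2,4,3,0,0,0,0,0,0,0,0],
    Negative [0,0,0,0,0,4,0,1,4,0,-1,-5,-6,0,0,4,0,0,0,0],
    Negative [0,0,0,0,0,4,0,1,4,0,-1,-5,-6,0,0,4,0,0,0,0],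
    Negative [0,0,0,0,-3,5,0,0,4,0,-2,-4,-3,0,0,0,0,0,0,0,0],
    Negative [0,0,0,-2,2,-3,0,0,0,0,1,2,2,0,0,-2,0,0,0,0,0],
    Negative [0,0,0,-2,2,-3,0,0,0,0,1,2,2,0,0,-2,0,0,0,0,0],
    Negative [0,2,0,-4,4,-6,0,0,0,0,3,3,3,0,0,-2,0,0,0,0,0,0]]]]],
    Contains 30 [0,1,2,3,4,5,6,7,8,9,10,11,13,12,14],
    Branch 6 [Negative [-10,8,4,-6,8,4,-7,-3,0,0,0,0,0,0,0,0],
    Negative [-10,8,4,-6,8,4,-7,-3,0,0,0,0,0,0,0,0],
    Negative [0,-2,0,3,-2,1,2,-1,-1,0,0,0,0,0,0,0],
    Negative [0,-2,0,3,-2,1,2,-1,-1,0,0,0,0,0,0,0],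
    Negative [0,0,-2,4,-2,1,2,0,-2,0,0,0,0,0,0,0], Negative [0,0,-2,4,-2,1,2,0,-2,0,0,0,0,0,0,0],
    Negative [-3,7,0,-8,7,-3,-6,0,3,0,0,0,0,0,0,0,0],
    Contains 30 [3,4,0,1,2,8,9,5,6,7,14,15,10,11,12],
    Contains 30 [3,4,0,1,2,8,9,5,6,7,14,15,10,11,13], Contains 14 [1,2,3,4,0,6,7,8,9,5,14,10,15],
    Contains 14 [1,2,3,4,0,6,7,8,9,5,15,10,14], Contains 30 [3,4,0,1,2,8,9,5,6,7,14,15,10,11,16],
    Contains 30 [3,4,0,1,2,8,9,5,6,7,14,15,11,10,12],
    Contains 30 [3,4,0,1,2,8,9,5,6,7,14,15,11,10,13], Contains 14 [1,2,3,4,0,6,7,8,9,5,14,11,15],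
    Contains 14 [1,2,3,4,0,6,7,8,9,5,15,11,14], Contains 30 [3,4,0,1,2,8,9,5,6,7,14,15,11,10,16],
    Negative [0,-2,0,2,0,0,2,-1,-2,0,0,0,0,0,0,0], Negative [0,-2,0,2,0,0,2,-1,-2,0,0,0,0,0,0,0],
    Branch 9 [Negative [0,0,0,-6,0,-2,0,5,4,6,0,0,-7,0,0,0,0],
    Contains 14 [2,3,4,0,1,7,8,9,5,6,13,12,10], Contains 30 [1,2,3,4,0,6,7,8,9,5,12,16,14,15,10],
    Contains 30 [1,2,3,4,0,6,7,8,9,5,12,16,15,14,10],
    Negative [0,-2,0,0,2,0,2,0,-1,-2,0,0,0,0,0,0,0],
    Negative [0,-15,7,11,0,7,10,-7,-10,-6,0,0,0,0,0,0,0,0],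
    Negative [0,0,0,-6,0,-2,0,5,4,6,0,0,-7,0,0,0,0], Contains 14 [2,3,4,0,1,7,8,9,5,6,13,12,11],
    Contains 30 [1,2,3,4,0,6,7,8,9,5,12,16,14,15,11],
    Contains 30 [1,2,3,4,0,6,7,8,9,5,12,16,15,14,11],
    Negative [0,-2,0,0,2,0,2,0,-1,-2,0,0,0,0,0,0,0],
    Negative [0,-15,7,11,0,7,10,-7,-10,-6,0,0,0,0,0,0,0,0],
    Negative [0,0,0,-2,2,0,0,2,1,0,0,0,-2,0,0,0,0],
    Negative [0,0,0,-2,2,0,0,2,1,0,0,0,-2,0,0,0,0],
    Negative [0,0,0,-2,2,0,0,2,1,0,0,0,-2,0,0,0,0,0],
    Negative [0,0,0,-3,3,-1,0,2,2,-2,0,0,0,0,0,0,0],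
    Negative [0,0,0,-3,3,-1,0,2,2,-2,0,0,0,0,0,0,0],
    Negative [0,0,-2,0,2,0,1,2,0,-2,0,0,0,0,0,0,0],
    Negative [0,0,-2,0,2,-1,0,2,0,-2,0,0,0,0,0,0,0,0],
    Contains 14 [1,0,4,3,2,6,5,9,8,7,16,12,14],
    Negative [0,-5,5,5,-5,3,3,-4,-4,3,0,0,0,0,0,0,0,0],
    Contains 14 [1,0,4,3,2,6,5,9,8,7,16,12,15],
    Negative [0,-5,5,5,-5,3,3,-4,-4,3,0,0,0,0,0,0,0,0],
    Negative [0,-2,0,0,2,0,2,0,-1,-2,0,0,0,0,0,0,0,0],
    Contains 30 [4,0,1,2,3,9,5,6,7,8,17,18,12,16,13]],
    Negative [0,-2,0,2,0,0,2,-1,-2,0,0,0,0,0,0,0], Negative [0,-2,0,2,0,0,2,-1,-2,0,0,0,0,0,0,0],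
    Contains 31 [0,1,2,3,4,5,6,7,8,9,10,11,13,12,14,15,16],
    Negative [0,-2,0,2,0,1,2,0,-2,0,0,0,0,0,0,0,0],
    Negative [0,-2,0,2,0,1,2,0,-2,0,0,0,0,0,0,0,0],
    Branch 12 [Negative [0,0,0,-2,2,0,0,2,1,0,0,0,-2,0,0,0,0,0],
    Negative [0,0,0,-2,2,0,0,2,1,0,0,0,-2,0,0,0,0,0],
    Negative [0,0,0,-1,1,0,0,1,1,0,0,0,-1,0,0,0,0,0],
    Negative [0,0,0,-1,1,0,0,1,1,0,0,0,-1,0,0,0,0,0],
    Negative [0,0,0,-2,2,0,0,2,1,0,0,0,-2,0,0,0,0,0],
    Negative [0,0,0,-2,2,0,0,2,1,0,0,0,-2,0,0,0,0,0],
    Negative [0,0,0,-2,2,0,0,2,1,0,0,0,-2,0,0,0,0,0,0],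
    Negative [0,0,0,-2,0,1,0,2,2,0,0,0,-2,0,0,0,0,0],
    Negative [0,0,0,-2,0,1,0,2,2,0,0,0,-2,0,0,0,0,0],
    Negative [0,-1,0,0,0,1,1,1,0,0,0,0,-1,0,0,0,0,0],
    Negative [0,-1,0,0,0,1,1,1,0,0,0,0,-1,0,0,0,0,0],
    Negative [-2,-7,4,-3,3,5,4,5,0,0,0,0,-6,0,0,0,0,0,0],
    Negative [0,0,0,-2,0,1,0,2,2,0,0,0,-2,0,0,0,0,0],
    Negative [0,0,0,-2,0,1,0,2,2,0,0,0,-2,0,0,0,0,0],
    Negative [0,-1,0,0,0,1,1,1,0,0,0,0,-1,0,0,0,0,0],
    Negative [0,-1,0,0,0,1,1,1,0,0,0,0,-1,0,0,0,0,0],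
    Negative [-2,-7,4,-3,3,5,4,5,0,0,0,0,-6,0,0,0,0,0,0],
    Negative [0,0,0,-2,0,0,1,2,2,0,0,0,-2,0,0,0,0,0],
    Negative [0,0,0,-2,0,0,1,2,2,0,0,0,-2,0,0,0,0,0],
    Negative [0,0,0,-2,1,0,0,2,2,0,0,0,-2,0,0,0,0,0,0],
    Negative [0,0,0,-2,0,0,1,2,2,0,0,0,-2,0,0,0,0,0],
    Negative [0,0,0,-2,0,0,1,2,2,0,0,0,-2,0,0,0,0,0],
    Negative [0,0,0,-2,1,0,0,2,2,0,0,0,-2,0,0,0,0,0,0],
    Negative [0,-2,0,0,0,1,2,2,0,0,0,0,-2,0,0,0,0,0,0],
    Negative [0,-2,0,0,0,1,2,2,0,0,0,0,-2,0,0,0,0,0,0],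
    Branch 13 [Negative [0,0,0,-2,2,0,0,2,0,0,0,0,-1,-2,0,0,0,0,0,0],
    Negative [0,0,0,-2,2,0,0,2,0,0,0,0,-1,-2,0,0,0,0,0,0],
    Negative [0,0,0,-2,0,0,0,2,2,0,0,0,-1,-2,0,0,0,0,0,0],
    Negative [0,0,0,-2,0,0,0,2,2,0,0,0,-1,-2,0,0,0,0,0,0],
    Negative [0,0,0,-2,2,0,0,2,0,0,0,0,-1,-2,0,0,0,0,0,0],
    Negative [0,0,0,-2,2,0,0,2,0,0,0,0,-1,-2,0,0,0,0,0,0],
    Negative [0,0,0,-2,2,0,0,2,0,0,0,0,-1,-2,0,0,0,0,0,0,0],
    Negative [0,0,0,-2,0,0,0,2,2,0,0,0,-1,-2,0,0,0,0,0,0],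
    Negative [0,0,0,-2,0,0,0,2,2,0,0,0,-1,-2,0,0,0,0,0,0],
    Negative [0,0,0,-4,2,0,1,4,2,0,0,0,-2,-2,0,0,0,0,0,0],
    Negative [0,0,0,-4,2,0,1,4,2,0,0,0,-2,-2,0,0,0,0,0,0],
    Negative [0,-3,0,0,0,2,2,4,0,0,0,0,-2,-3,0,0,0,0,0,0,0],
    Negative [0,0,0,-2,0,0,0,2,2,0,0,0,-1,-2,0,0,0,0,0,0],
    Negative [0,0,0,-2,0,0,0,2,2,0,0,0,-1,-2,0,0,0,0,0,0],
    Negative [0,0,0,-4,2,0,1,4,2,0,0,0,-2,-2,0,0,0,0,0,0],
    Negative [0,0,0,-4,2,0,1,4,2,0,0,0,-2,-2,0,0,0,0,0,0],
    Negative [0,-3,0,0,0,2,2,4,0,0,0,0,-2,-3,0,0,0,0,0,0,0],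
    Negative [0,0,0,-2,0,0,0,2,2,0,0,0,-1,-2,0,0,0,0,0,0],
    Negative [0,0,0,-2,0,0,0,2,2,0,0,0,-1,-2,0,0,0,0,0,0],
    Negative [0,0,0,-2,0,0,0,2,2,0,0,0,-1,-2,0,0,0,0,0,0,0],
    Negative [0,0,0,-2,0,0,0,2,2,0,0,0,-1,-2,0,0,0,0,0,0],
    Negative [0,0,0,-2,0,0,0,2,2,0,0,0,-1,-2,0,0,0,0,0,0],
    Negative [0,0,0,-2,0,0,0,2,2,0,0,0,-1,-2,0,0,0,0,0,0,0],
    Negative [0,0,0,-4,2,0,1,4,2,0,0,0,-2,-2,0,0,0,0,0,0,0],
    Negative [0,0,0,-4,2,0,1,4,2,0,0,0,-2,-2,0,0,0,0,0,0,0],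
    Negative [0,0,0,-4,2,-1,0,4,2,0,0,0,-2,-2,0,0,0,0,0,0,0,0]]]]]]]]]]]]"

text \<open>The numbers 0 and 1 in the certificate stand for the two graphs given here at the start;
  each is cited at exactly one leaf. The final list is irrelevant, so the evaluation only shows that
  it is not \<open>None\<close>.\<close>

lemma certificate_valid:
  "\<exists>K. check_cert [petersen_lists, dodecahedral_lists] pentagon_lists pentagon_certificate = Some K"
proof -
  have "check_cert [petersen_lists, dodecahedral_lists] pentagon_lists pentagon_certificate \<noteq> None" by code_simp
  then show ?thesis by blast
qed

section \<open>Recognising the two graphs\<close>

text \<open>Arcs are pairs of vertices, so a bijection of the vertices that respects adjacency in
  both directions induces the map on arcs.\<close>

lemma digraph_iso_with_projI:
  assumes "pair_wf_digraph G" and f: "bij_betw f (pverts G) (pverts H)"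
    and H: "parcs H \<subseteq> pverts H \<times> pverts H"
    and adj: "\<And>u v. u \<in> pverts G \<Longrightarrow> v \<in> pverts G \<Longrightarrow> (f u, f v) \<in> parcs H \<longleftrightarrow> (u, v) \<in> parcs G"
  shows "digraph_iso (with_proj G) (with_proj H)"
proof -
  interpret pair_wf_digraph G by fact
  have G: "parcs G \<subseteq> pverts G \<times> pverts G"
    by (auto dest: in_arcsD1 in_arcsD2)
  define hom where "hom = \<lparr>iso_verts = f, iso_arcs = map_prod f f, iso_head = snd, iso_tail = fst\<rparr>"
  have inj: "inj_on f (pverts G)" and im: "f ` pverts G = pverts H" using f by (auto simp: bij_betw_def)
  have "inj_on (map_prod f f) (parcs G)"
    using map_prod_inj_on[OF inj inj] G by (rule inj_on_subset)
  then have "pre_digraph.digraph_isomorphism (with_proj G) hom"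
    using wf_digraph inj by (simp add: pre_digraph.digraph_isomorphism_def hom_def)
  moreover have "map_prod f f ` parcs G = parcs H"
  proof (intro subset_antisym subsetI)
    fix e assume "e \<in> parcs H"
    moreover obtain a b where e: "e = (a, b)" by (cases e)
    ultimately have ab: "a \<in> pverts H" "b \<in> pverts H" "(a, b) \<in> parcs H" using H by auto
    then obtain u v where uv: "u \<in> pverts G" "v \<in> pverts G" "a = f u" "b = f v"
      using im by (metis imageE)
    then have "(u, v) \<in> parcs G" using adj ab by simp
    then show "e \<in> map_prod f f ` parcs G" using uv e by (auto intro: image_eqI)
  next
    fix e assume "e \<in> map_prod f f ` parcs G"
    then obtain u v where uv: "(u, v) \<in> parcs G" "e = (f u, f v)" by auto
    then show "e \<in> parcs H" using adj[of u v] G by auto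
  qed
  then have "with_proj H = app_iso hom (with_proj G)"
    using im by (simp add: app_iso_def hom_def with_proj_def)
  ultimately show ?thesis unfolding digraph_iso_def by blast
qed

text \<open>In contrast to an embedding, \<psi> is an isomorphism: it is onto and respects non-edges
  as well.\<close>

definition adj_lists_of :: "adj_lists \<Rightarrow> 'b pair_pre_digraph \<Rightarrow> (nat \<Rightarrow> 'b) \<Rightarrow> bool" where
  "adj_lists_of g H \<psi> \<longleftrightarrow> bij_betw \<psi> {..<length g} (pverts H) \<and> parcs H \<subseteq> pverts H \<times> pverts H \<and>
     (\<forall>i<length g. \<forall>j<length g. (\<psi> i, \<psi> j) \<in> parcs H \<longleftrightarrow> j \<in> set (g ! i))"

context spectral_cubic_graph
begin

text \<open>All degrees being used up, the image is closed under neighbours, hence is all of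
  \<open>V\<close> by connectedness, and G has no edges beyond the listed ones. So \<phi> is an
  isomorphism, to be composed with \<psi>.\<close>

lemma embedding_saturated_iso:
  assumes \<phi>: "embedding \<phi> g" and g: "wf_adj_lists g" "\<forall>ns\<in>set g. length ns = 3" "g \<noteq> []"
    and G: "pair_wf_digraph G" "pverts G = V" "\<And>x. N x = {y. (x, y) \<in> parcs G}"
    and connected: "\<forall>S. S \<subseteq> V \<longrightarrow> S \<noteq> {} \<longrightarrow> (\<forall>x\<in>S. N x \<subseteq> S) \<longrightarrow> S = V"
    and H: "adj_lists_of g H \<psi>"
  shows "digraph_iso (with_proj G) (with_proj H)"
proof -
  define n where "n = length g"
  have inj: "inj_on \<phi> {..<n}" and V: "\<phi> ` {..<n} \<subseteq> V"
    using \<phi> unfolding embedding_def n_def by blast+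
  have sat: "N (\<phi> i) = \<phi> ` set (g ! i)" if "i < n" for i
    using N_saturated[OF \<phi> g(1)] g(2) that by (simp add: n_def)
  have gn: "set (g ! i) \<subseteq> {..<n}" if "i < n" for i
    using wf_adj_listsD(3)[OF g(1)] that by (auto simp: n_def)
  have "\<phi> ` {..<n} \<noteq> {}" using g(3) by (auto simp: n_def)
  moreover have "\<forall>x\<in>\<phi> ` {..<n}. N x \<subseteq> \<phi> ` {..<n}" using sat gn by force
  ultimately have "\<phi> ` {..<n} = V" using connected V by blast
  with inj have bij: "bij_betw \<phi> {..<n} V" by (simp add: bij_betw_def)
  define f where "f = \<psi> \<circ> the_inv_into {..<n} \<phi>"
  have f: "f (\<phi> i) = \<psi> i" if "i < n" for i using that inj by (simp add: f_def the_inv_into_f_f)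
  show ?thesis
  proof (rule digraph_iso_with_projI[OF G(1)])
    show "bij_betw f (pverts G) (pverts H)"
      unfolding f_def G(2)
      using H by (intro bij_betw_trans[OF bij_betw_the_inv_into[OF bij]]) (simp add: adj_lists_of_def n_def)
    show "parcs H \<subseteq> pverts H \<times> pverts H" using H by (simp add: adj_lists_of_def)
    fix u v assume "u \<in> pverts G" "v \<in> pverts G"
    then obtain i j where ij: "i < n" "j < n" "u = \<phi> i" "v = \<phi> j"
      using bij unfolding G(2) bij_betw_def by blast
    have "(u, v) \<in> parcs G \<longleftrightarrow> \<phi> j \<in> N (\<phi> i)" using ij G(3) by simp
    also have "\<dots> \<longleftrightarrow> j \<in> set (g ! i)"
      using sat gn ij inj by (auto simp: subset_iff dest: inj_onD)
    also have "\<dots> \<longleftrightarrow> (\<psi> i, \<psi> j) \<in> parcs H" using H ij by (simp add: adj_lists_of_def n_def)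
    finally show "(f u, f v) \<in> parcs H \<longleftrightarrow> (u, v) \<in> parcs G" using ij f by simp
  qed
qed

end

section \<open>Labellings of the Petersen graph and the dodecahedron\<close>

definition petersen_pairs :: "(nat \<times> nat) list" where
  "petersen_pairs = [(0,1), (2,3), (0,4), (1,2), (3,4), (2,4), (1,4), (1,3), (0,3), (0,2)]"

text \<open>Two-element sets are represented by ordered pairs, so that distinctness and disjointness
  reduce to comparisons of numbers that can be evaluated.\<close>

lemma petersen_pairs_props:
  "\<forall>i\<in>set [0..<10]. \<forall>j\<in>set [0..<10].
     (\<lambda>(a, b) (c, d). a \<noteq> b \<and> a < 5 \<and> b < 5 \<and>
       (i = j \<or> \<not> (a = c \<and> b = d \<or> a = d \<and> b = c)) \<and>
       (j \<in> set (petersen_lists ! i) \<longleftrightarrow> a \<noteq> c \<and> a \<noteq> d \<and> b \<noteq> c \<and> b \<noteq> d))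
     (petersen_pairs ! i) (petersen_pairs ! j)"
  by code_simp

lemma adj_lists_of_petersen:
  "adj_lists_of petersen_lists petersen_graph (\<lambda>i. case petersen_pairs ! i of (a, b) \<Rightarrow> {a, b})"
  (is "adj_lists_of _ _ ?\<psi>")
proof -
  have len: "length petersen_lists = 10" by (simp add: petersen_lists_def)
  have pairs: "\<exists>a b c d. petersen_pairs ! i = (a, b) \<and> petersen_pairs ! j = (c, d) \<and> a \<noteq> b \<and> a < 5 \<and> b < 5 \<and>
      (i = j \<or> {a, b} \<noteq> {c, d}) \<and> (j \<in> set (petersen_lists ! i) \<longleftrightarrow> {a, b} \<inter> {c, d} = {})"
    if "i < 10" "j < 10" for i j
  proof -
    obtain a b c d where *: "petersen_pairs ! i = (a, b)" "petersen_pairs ! j = (c, d)"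
      by (metis surj_pair)
    have ij: "i \<in> set [0..<10]" "j \<in> set [0..<10]" using that by simp_all
    have "a \<noteq> b \<and> a < 5 \<and> b < 5 \<and> (i = j \<or> \<not> (a = c \<and> b = d \<or> a = d \<and> b = c)) \<and>
       (j \<in> set (petersen_lists ! i) \<longleftrightarrow> a \<noteq> c \<and> a \<noteq> d \<and> b \<noteq> c \<and> b \<noteq> d)"
      using bspec[OF bspec[OF petersen_pairs_props ij(1)] ij(2)] unfolding * prod.case .
    then show ?thesis unfolding * by (auto simp: doubleton_eq_iff)
  qed
  have inj: "inj_on ?\<psi> {..<10}"
  proof (rule inj_onI)
    fix i j :: nat assume "i \<in> {..<10}" "j \<in> {..<10}" "?\<psi> i = ?\<psi> j"
    then show "i = j" using pairs[of i j] by auto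
  qed
  have sub: "?\<psi> ` {..<10} \<subseteq> pverts petersen_graph"
  proof (rule image_subsetI)
    fix i :: nat assume "i \<in> {..<10}"
    then show "?\<psi> i \<in> pverts petersen_graph" using pairs[of i i] by (auto simp: petersen_graph_def)
  qed
  \<comment> \<open>Surjectivity by counting: a 5-set has 10 subsets of size 2.\<close>
  have "card (pverts petersen_graph) = 10"
    using n_subsets[of "{..<5::nat}" 2] by (simp add: petersen_graph_def choose_two)
  then have "?\<psi> ` {..<10} = pverts petersen_graph"
    using sub card_image[OF inj] by (intro card_subset_eq) (auto intro: card_ge_0_finite)
  with inj have bij: "bij_betw ?\<psi> {..<10} (pverts petersen_graph)" by (simp add: bij_betw_def)
  have "(?\<psi> i, ?\<psi> j) \<in> parcs petersen_graph \<longleftrightarrow> j \<in> set (petersen_lists ! i)"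
    if ij: "i < 10" "j < 10" for i j
  proof -
    have "?\<psi> i \<in> pverts petersen_graph" "?\<psi> j \<in> pverts petersen_graph" using sub ij by auto
    then have "(?\<psi> i, ?\<psi> j) \<in> parcs petersen_graph \<longleftrightarrow> ?\<psi> i \<inter> ?\<psi> j = {}"
      by (simp add: petersen_graph_def)
    moreover obtain a b c d where "petersen_pairs ! i = (a, b)" "petersen_pairs ! j = (c, d)"
      "j \<in> set (petersen_lists ! i) \<longleftrightarrow> {a, b} \<inter> {c, d} = {}"
      using pairs[OF ij] by blast
    ultimately show ?thesis by (simp only: prod.case)
  qed
  moreover have "parcs petersen_graph \<subseteq> pverts petersen_graph \<times> pverts petersen_graph"
    by (auto simp: petersen_graph_def)
  ultimately show ?thesis using bij unfolding adj_lists_of_def len by blast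
qed

definition dodecahedral_label :: "nat \<Rightarrow> bool \<times> nat" where
  "dodecahedral_label i = (if i < 10 then (False, i) else (True, i - 10))"

lemma dodecahedral_label_adj:
  "\<forall>i\<in>set [0..<20]. \<forall>j\<in>set [0..<20].
     dodecahedral_adj (dodecahedral_label i) (dodecahedral_label j) \<longleftrightarrow> j \<in> set (dodecahedral_lists ! i)"
  by code_simp

lemma adj_lists_of_dodecahedral: "adj_lists_of dodecahedral_lists dodecahedral_graph dodecahedral_label"
proof -
  have len: "length dodecahedral_lists = 20" by (simp add: dodecahedral_lists_def)
  have V: "pverts dodecahedral_graph = UNIV \<times> {..<10}"
    by (simp add: dodecahedral_graph_def generalized_petersen_def Let_def)
  have "bij_betw dodecahedral_label {..<20} (pverts dodecahedral_graph)"
    unfolding V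
    by (rule bij_betwI[where g = "\<lambda>(b, i). if b then i + 10 else i"])
      (auto simp: dodecahedral_label_def split: if_splits)
  moreover have "parcs dodecahedral_graph \<subseteq> pverts dodecahedral_graph \<times> pverts dodecahedral_graph"
    unfolding V by (auto simp: dodecahedral_graph_def generalized_petersen_def Let_def)
  moreover have "(dodecahedral_label i, dodecahedral_label j) \<in> parcs dodecahedral_graph \<longleftrightarrow> j \<in> set (dodecahedral_lists ! i)"
    if ij: "i < 20" "j < 20" for i j
  proof -
    obtain b k c l where eq: "dodecahedral_label i = (b, k)" "dodecahedral_label j = (c, l)"
      by (metis surj_pair)
    have "k < 10" "l < 10" using ij eq by (auto simp: dodecahedral_label_def split: if_splits)
    then have "(dodecahedral_label i, dodecahedral_label j) \<in> parcs dodecahedral_graph \<longleftrightarrow>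
        dodecahedral_adj (dodecahedral_label i) (dodecahedral_label j)"
      unfolding eq
      by (cases b; cases c)
        (auto simp: dodecahedral_graph_def generalized_petersen_def Let_def dodecahedral_adj_def)
    moreover have "i \<in> set [0..<20]" "j \<in> set [0..<20]" using ij by simp_all
    ultimately show ?thesis using dodecahedral_label_adj by blast
  qed
  ultimately show ?thesis by (simp add: adj_lists_of_def len)
qed

section \<open>Short cycles and connectedness\<close>

lemma girth_le_cycle:
  assumes "pre_digraph.cycle (with_proj G) p" "3 \<le> length p"
  shows "girth G \<le> enat (length p)"
  unfolding girth_def using assms by (intro INF_lower) simp

text \<open>A finite infimum excludes the empty set of cycles, and a nonempty set of extended
  naturals contains its infimum.\<close>

lemma girth_attained:
  assumes "girth G = enat n"
  obtains p where "pre_digraph.cycle (with_proj G) p" "length p = n"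
proof -
  let ?A = "(\<lambda>p. enat (length p)) ` {p. pre_digraph.cycle (with_proj G) p \<and> 3 \<le> length p}"
  have "Inf ?A = enat n" using assms by (simp add: girth_def)
  then have "?A \<noteq> {}" by (metis Inf_empty enat.distinct(1) top_enat_def)
  then have "Inf ?A \<in> ?A"
    unfolding Inf_enat_def by (auto intro: LeastI)
  then show thesis using \<open>Inf ?A = enat n\<close> that by auto
qed

context pair_wf_digraph
begin

lemma cycle_of_three:
  assumes "(x, y) \<in> parcs G" "(y, z) \<in> parcs G" "(z, x) \<in> parcs G" "x \<noteq> y" "y \<noteq> z" "z \<noteq> x"
  shows "cycle [(x, y), (y, z), (z, x)]"
  using assms in_arcsD1 by (auto simp: cycle_def awalk_def)

lemma cycle_of_four:
  assumes "(x, y) \<in> parcs G" "(y, z) \<in> parcs G" "(z, w) \<in> parcs G" "(w, x) \<in> parcs G"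
    "distinct [x, y, z, w]"
  shows "cycle [(x, y), (y, z), (z, w), (w, x)]"
  using assms in_arcsD1 by (auto simp: cycle_def awalk_def)

lemma cycle_length_five:
  assumes "cycle p" "length p = 5"
  obtains a b c d e where "distinct [a, b, c, d, e]"
    "(a, b) \<in> parcs G" "(b, c) \<in> parcs G" "(c, d) \<in> parcs G" "(d, e) \<in> parcs G" "(e, a) \<in> parcs G"
proof -
  obtain u where u: "set p \<subseteq> parcs G" "pcas u p u" "distinct (tl (pawalk_verts u p))"
    using assms(1) by (auto simp: cycle_def awalk_def)
  obtain e1 e2 e3 e4 e5 where p: "p = [e1, e2, e3, e4, e5]"
    using assms(2) by (auto simp: eval_nat_numeral length_Suc_conv)
  have "\<exists>a b c d e. p = [(a, b), (b, c), (c, d), (d, e), (e, a)]"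
    using u(2) unfolding p by (cases e1; cases e2; cases e3; cases e4; cases e5) auto
  then obtain a b c d e where "p = [(a, b), (b, c), (c, d), (d, e), (e, a)]" by blast
  with u show thesis by (intro that[of a b c d e]) auto
qed

end

text \<open>Connectedness speaks of paths in the symmetric closure, so \<open>S\<close> has to be
  closed along arcs in both directions; induction along a path then reaches every vertex.\<close>

lemma connected_closed_set:
  assumes conn: "Digraph_Component.connected (with_proj G)"
    and S: "S \<subseteq> pverts G" "S \<noteq> {}"
    and closed: "\<And>x y. x \<in> S \<Longrightarrow> (x, y) \<in> parcs G \<or> (y, x) \<in> parcs G \<Longrightarrow> y \<in> S"
  shows "S = pverts G"
proof (rule subset_antisym[OF S(1)], rule subsetI)
  fix y assume y: "y \<in> pverts G"
  obtain x where x: "x \<in> S" using S by blast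
  let ?H = "mk_symmetric (with_proj G)"
  have "(x, y) \<in> rtrancl_on (pverts ?H) (parcs ?H)"
    using conn x y S(1)
    by (auto simp: Digraph_Component.connected_def strongly_connected_def reachable_def mk_symmetric_def)
  then show "y \<in> S"
  proof (rule rtrancl_on_induct[where P = "\<lambda>z. z \<in> S"])
    show "c \<in> S" if "(b, c) \<in> parcs ?H" "b \<in> S" for b c
      using that closed[of b c] by (auto simp: mk_symmetric_def)
  qed (rule x)
qed


theorem theorem5p1:
  fixes G :: "'a pair_pre_digraph" and vs :: "'a list"
  assumes "pair_graph G"
    and "Digraph_Component.connected (with_proj G)"
    and "\<forall>v \<in> pverts G. out_degree (with_proj G) v = 3"
    and "girth G = 5"
    and "distinct vs" and "set vs = pverts G"
    and "\<forall>x. eigenvalue (adjacency_matrix G vs) x \<longrightarrow> x \<notin> {-2<..<0}"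
  shows "digraph_iso (with_proj G) (with_proj petersen_graph) \<or>
         digraph_iso (with_proj G) (with_proj dodecahedral_graph)"
proof -
  interpret pair_graph G by fact
  define N where "N x = {y. (x, y) \<in> parcs G}" for x
  have girth5: "girth G = enat 5" using assms(4) by (simp add: numeral_eq_enat)
  have sym: "(y, x) \<in> parcs G" if "(x, y) \<in> parcs G" for x y
    using that pair_sym_arcs by (auto simp: symmetric_def dest: symD)
  have irrefl: "(x, x) \<notin> parcs G" for x using pair_no_loops[of "(x, x)"] by auto
  have arcV: "x \<in> pverts G" "y \<in> pverts G" if "(x, y) \<in> parcs G" for x y
    using that by (auto dest: in_arcsD1 in_arcsD2)
  interpret spectral_cubic_graph "pverts G" N
  proof
    show "finite (pverts G)" by (rule pair_finite_verts)
    show N_sub: "N x \<subseteq> pverts G" for x using arcV by (auto simp: N_def)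
    show N_sym: "x \<in> N y" if "y \<in> N x" for x y using that sym by (simp add: N_def)
    show N_irrefl: "x \<notin> N x" for x using irrefl by (simp add: N_def)
    show "card (N x) = 3" if "x \<in> pverts G" for x
    proof -
      have "out_arcs (with_proj G) x = Pair x ` N x" by (auto simp: out_arcs_def N_def)
      then have "card (N x) = out_degree (with_proj G) x"
        by (simp add: out_degree_def card_image inj_on_def)
      then show ?thesis using assms(3) that by simp
    qed
    show "z \<notin> N y" if "y \<in> N x" "z \<in> N x" for x y z
    proof
      assume "z \<in> N y"
      then have "cycle [(x, y), (y, z), (z, x)]"
        using that sym irrefl by (intro cycle_of_three) (auto simp: N_def)
      from girth_le_cycle[OF this] show False using girth5 by simp
    qed
    show "y = w" if "x \<noteq> z" "y \<in> N x" "y \<in> N z" "w \<in> N x" "w \<in> N z" for x y z w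
    proof (rule ccontr)
      assume "y \<noteq> w"
      then have "cycle [(x, y), (y, z), (z, w), (w, x)]"
        using that sym irrefl by (intro cycle_of_four) (auto simp: N_def)
      from girth_le_cycle[OF this] show False using girth5 by simp
    qed
    show "(\<Sum>x\<in>pverts G. (f x)\<^sup>2) \<le> (\<Sum>x\<in>pverts G. (f x + sum f (N x))\<^sup>2)" for f :: "'a \<Rightarrow> real"
    proof (rule ccontr)
      assume "\<not> ?thesis"
      then have "(\<Sum>x\<in>pverts G. (f x + sum f (N x))\<^sup>2) < (\<Sum>x\<in>pverts G. (f x)\<^sup>2)" by simp
      then obtain k :: real and h :: "'a \<Rightarrow> real" where k: "- 2 < k" "k < 0" "\<exists>x\<in>pverts G. h x \<noteq> 0"
        "\<And>x. x \<in> pverts G \<Longrightarrow> sum h (N x) = k * h x"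
        using adjacency_eigenfunction[OF pair_finite_verts N_sub N_sym N_irrefl] by blast
      have "N x = {y. y \<in> set vs \<and> (x, y) \<in> parcs G}" for x
        using arcV assms(6) by (auto simp: N_def)
      then have "eigenvalue (adjacency_matrix G vs) k"
        using k assms(5,6) by (intro eigenvalue_adjacency_matrixI[where h = h]) auto
      with assms(7) k show False by auto
    qed
  qed
  have connected: "\<forall>S. S \<subseteq> pverts G \<longrightarrow> S \<noteq> {} \<longrightarrow> (\<forall>x\<in>S. N x \<subseteq> S) \<longrightarrow> S = pverts G"
  proof (intro allI impI)
    fix S assume S: "S \<subseteq> pverts G" "S \<noteq> {}" "\<forall>x\<in>S. N x \<subseteq> S"
    show "S = pverts G"
    proof (rule connected_closed_set[OF assms(2) S(1,2)])
      fix x y assume "x \<in> S" "(x, y) \<in> parcs G \<or> (y, x) \<in> parcs G"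
      then show "y \<in> S" using S(3) sym by (auto simp: N_def)
    qed
  qed
  \<comment> \<open>This is the instance of \<open>P\<close>: each target graph forces it by
    recognition, and soundness of the certificate transfers it to the pentagon.\<close>
  let ?thesis' = "digraph_iso (with_proj G) (with_proj petersen_graph) \<or>
         digraph_iso (with_proj G) (with_proj dodecahedral_graph)"
  have G: "pair_wf_digraph G" by unfold_locales
  have wf: "wf_adj_lists petersen_lists" "wf_adj_lists dodecahedral_lists" by code_simp+
  have "\<forall>ns\<in>set petersen_lists. length ns = 3" "petersen_lists \<noteq> []" by code_simp+
  then have "embedding_forces ?thesis' petersen_lists"
    unfolding embedding_forces_def
    using embedding_saturated_iso[OF _ wf(1) _ _ G refl N_def connected adj_lists_of_petersen] by blast
  moreover have "\<forall>ns\<in>set dodecahedral_lists. length ns = 3" "dodecahedral_lists \<noteq> []" by code_simp+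
  then have "embedding_forces ?thesis' dodecahedral_lists"
    unfolding embedding_forces_def
    using embedding_saturated_iso[OF _ wf(2) _ _ G refl N_def connected adj_lists_of_dodecahedral] by blast
  moreover have "closed_adj_lists petersen_lists" "closed_adj_lists dodecahedral_lists" by code_simp+
  ultimately have "embedding_forces ?thesis' pentagon_lists"
    using certificate_valid check_cert_sound[of "[petersen_lists, dodecahedral_lists]" pentagon_lists _ _ ?thesis']
    by (metis empty_iff empty_set set_ConsD)
  moreover obtain p where "cycle p" "length p = 5"
    using girth_attained[OF girth5] by blast
  then obtain a b c d e where abcde: "distinct [a, b, c, d, e]"
    "(a, b) \<in> parcs G" "(b, c) \<in> parcs G" "(c, d) \<in> parcs G" "(d, e) \<in> parcs G" "(e, a) \<in> parcs G"
    by (rule cycle_length_five)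
  have "embedding ((!) [a, b, c, d, e]) pentagon_lists"
    unfolding embedding_def
  proof (intro conjI)
    show "inj_on ((!) [a, b, c, d, e]) {..<length pentagon_lists}"
      using abcde(1) by (intro inj_on_nth) (auto simp: pentagon_lists_def)
    have "(!) [a, b, c, d, e] ` {..<length pentagon_lists} = set [a, b, c, d, e]"
      by (simp add: pentagon_lists_def lessThan_Suc eval_nat_numeral) blast
    then show "(!) [a, b, c, d, e] ` {..<length pentagon_lists} \<subseteq> pverts G" using abcde arcV by auto
    show "\<forall>i<length pentagon_lists. \<forall>j\<in>set (pentagon_lists ! i). [a, b, c, d, e] ! j \<in> N ([a, b, c, d, e] ! i)"
      using abcde(2-) sym by (simp add: pentagon_lists_def N_def All_less_Suc eval_nat_numeral)
  qed
  ultimately show ?thesis unfolding embedding_forces_def by blast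
qed

end
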